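(* Let $d\in\mathbb{N}_0\cup\{\infty\}$ and let $L\in\mathbb{R}[\underline X]_{2d+2}^*$ be a linear form with $L(\sum\mathbb{R}[\underline X]_{d+1}^2)\subseteq\mathbb{R}_{\ge 0}$. Assume that the truncated GNS multiplication operators $M_{L,1},\dots,M_{L,n}$ of $L$ commute, and consider the set $$G_L:=\Big\{\sum_{i=1}^{s}p_iq_i : s\in\mathbb{N},\ p_i\in\mathbb{R}[\underline X]_{d+1}\text{ and } q_i\in\mathbb{R}[\underline X]_d+U_L\Big\}.$$ Then there exists a quadrature rule for $L$ on $G_L$ with $\dim(T_L)$ many nodes.
   Context: $n\in\mathbb{N}$, $\underline X=(X_1,\dots,X_n)$; for $k\in\mathbb{N}_0$, $\mathbb{R}[\underline X]_k$ is the space of real polynomials in $\underline X$ of degree at most $k$, and $\mathbb{R}[\underline X]_\infty:=\mathbb{R}[\underline X]$ (for $d=\infty$, the indices $d+1$ and $2d+2$ are read as $\infty$). $^*$ denotes the dual space, and $\sum\mathbb{R}[\underline X]_{d+1}^2$ is the set of finite sums of squares of elements of $\mathbb{R}[\underline X]_{d+1}$. For $L$ as in the claim: - the truncated GNS kernel is $U_L:=\{p\in\mathbb{R}[\underline X]_{d+1}: L(pq)=0\text{ for all }q\in\mathbb{R}[\underline X]_{d+1}\}$; - the GNS representation space is $V_L:=\mathbb{R}[\underline X]_{d+1}/U_L$, with classes written $\overline p^L$ and inner product $\langle\overline p^L,\overline q^L\rangle_L:=L(pq)$; - the GNS truncation is the subspace $T_L:=\{\overline p^L: p\in\mathbb{R}[\underline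 X]_d\}\subseteq V_L$, and $\Pi_L$ is the orthogonal projection of $V_L$ onto $T_L$; - the $i$-th truncated GNS multiplication operator is the self-adjoint endomorphism $M_{L,i}:T_L\to T_L$, $\overline p^L\mapsto\Pi_L(\overline{X_ip}^L)$ for $p\in\mathbb{R}[\underline X]_d$. A quadrature rule for $L$ on a set $U\subseteq\mathbb{R}[\underline X]_{2d+2}$ is a function $w:N\to\mathbb{R}_{>0}$ defined on a finite set $N\subseteq\mathbb{R}^n$ such that $L(p)=\sum_{x\in N}w(x)p(x)$ for all $p\in U$; the elements of $N$ are called its nodes.
   Formalization: For d = ∞ the formal theorem additionally assumes that T_L is finite-dimensional; without this no quadrature rule (finitely many nodes) with dim(T_L) nodes exists, e.g. n = 1 and L integration against a Gaussian. Nothing is added for d in N_0. *)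

theory Defs
  imports
    "HOL-Library.Poly_Mapping"
    "HOL-Library.Extended_Nat"
    "HOL-Analysis.Finite_Cartesian_Product"
    "Jordan_Normal_Form.VS_Connect"
begin

text \<open>
  Real polynomials in the variables \<open>X\<^sub>i\<close>, \<open>i :: 'n\<close>, are the finitely supported functions from
  monomials (exponent vectors \<open>'n \<Rightarrow>\<^sub>0 nat\<close>) to \<open>real\<close>; the ring structure is the convolution product
  of \<open>Poly_Mapping\<close>. The number of variables is \<open>n = CARD('n)\<close>.
\<close>

type_synonym 'n mpoly = "('n \<Rightarrow>\<^sub>0 nat) \<Rightarrow>\<^sub>0 real"

definition monom_degree :: "('n::finite \<Rightarrow>\<^sub>0 nat) \<Rightarrow> nat" where
  "monom_degree m = (\<Sum>i\<in>UNIV. Poly_Mapping.lookup m i)"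

definition mvar :: "'n \<Rightarrow> 'n mpoly" where
  "mvar i = Poly_Mapping.single (Poly_Mapping.single i 1) 1"

definition mconst :: "real \<Rightarrow> 'n mpoly" where
  "mconst c = Poly_Mapping.single 0 c"

definition meval :: "'n::finite mpoly \<Rightarrow> real ^ 'n \<Rightarrow> real" where
  "meval p x = (\<Sum>m\<in>Poly_Mapping.keys p. Poly_Mapping.lookup p m * (\<Prod>i\<in>UNIV. vec_nth x i ^ Poly_Mapping.lookup m i))"

text \<open>Polynomials of degree at most \<open>k\<close>; all polynomials if \<open>k = \<infinity>\<close>.\<close>

definition polys :: "enat \<Rightarrow> 'n::finite mpoly set" where
  "polys k = {p. \<forall>m\<in>Poly_Mapping.keys p. enat (monom_degree m) \<le> k}"

text \<open>
  An element of the dual space of \<open>polys k\<close> is given by a function on all polynomials, of which only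
  the values on \<open>polys k\<close> matter.
\<close>

definition linear_form :: "enat \<Rightarrow> ('n::finite mpoly \<Rightarrow> real) \<Rightarrow> bool" where
  "linear_form k L \<longleftrightarrow>
     (\<forall>p\<in>polys k. \<forall>q\<in>polys k. L (p + q) = L p + L q) \<and>
     (\<forall>c. \<forall>p\<in>polys k. L (mconst c * p) = c * L p)"

definition sums_of_squares :: "enat \<Rightarrow> 'n::finite mpoly set" where
  "sums_of_squares k = {\<Sum>i<s. p i ^ 2 | (s::nat) p. \<forall>i<s. p i \<in> polys k}"

definition gns_kernel :: "enat \<Rightarrow> ('n::finite mpoly \<Rightarrow> real) \<Rightarrow> 'n mpoly set" where
  "gns_kernel d L = {p \<in> polys (d + 1). \<forall>q\<in>polys (d + 1). L (p * q) = 0}"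

definition gns_rel :: "enat \<Rightarrow> ('n::finite mpoly \<Rightarrow> real) \<Rightarrow> ('n mpoly \<times> 'n mpoly) set" where
  "gns_rel d L = {(p, q). p \<in> polys (d + 1) \<and> q \<in> polys (d + 1) \<and> p - q \<in> gns_kernel d L}"

definition gns_class :: "enat \<Rightarrow> ('n::finite mpoly \<Rightarrow> real) \<Rightarrow> 'n mpoly \<Rightarrow> 'n mpoly set" where
  "gns_class d L p = gns_rel d L `` {p}"

text \<open>
  The quotient space \<open>V\<^sub>L\<close> of the polynomials of degree at most \<open>d + 1\<close> by the GNS kernel. The unions
  define the operations through arbitrary representatives; the fields \<open>mult\<close> and \<open>one\<close> play no role
  in a vector space.
\<close>

definition gns_space :: "enat \<Rightarrow> ('n::finite mpoly \<Rightarrow> real) \<Rightarrow> (real, 'n mpoly set) module" where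
  "gns_space d L =
    \<lparr> carrier = polys (d + 1) // gns_rel d L,
      mult = undefined, one = undefined,
      zero = gns_class d L 0,
      add = (\<lambda>A B. \<Union>p\<in>A. \<Union>q\<in>B. gns_class d L (p + q)),
      smult = (\<lambda>c A. \<Union>p\<in>A. gns_class d L (mconst c * p)) \<rparr>"

definition gns_inner ::
    "enat \<Rightarrow> ('n::finite mpoly \<Rightarrow> real) \<Rightarrow> 'n mpoly set \<Rightarrow> 'n mpoly set \<Rightarrow> real" where
  "gns_inner d L A B = (THE r. \<exists>p\<in>A. \<exists>q\<in>B. r = L (p * q))"

definition gns_trunc :: "enat \<Rightarrow> ('n::finite mpoly \<Rightarrow> real) \<Rightarrow> 'n mpoly set set" where
  "gns_trunc d L = gns_class d L ` polys d"

abbreviation gns_trunc_space ::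
    "enat \<Rightarrow> ('n::finite mpoly \<Rightarrow> real) \<Rightarrow> (real, 'n mpoly set) module" where
  "gns_trunc_space d L \<equiv> gns_space d L \<lparr> carrier := gns_trunc d L \<rparr>"

text \<open>Orthogonal projection of \<open>V\<^sub>L\<close> onto \<open>T\<^sub>L\<close>.\<close>

definition gns_proj :: "enat \<Rightarrow> ('n::finite mpoly \<Rightarrow> real) \<Rightarrow> 'n mpoly set \<Rightarrow> 'n mpoly set" where
  "gns_proj d L A =
     (THE B. B \<in> gns_trunc d L \<and>
             (\<forall>C\<in>gns_trunc d L. gns_inner d L (A \<ominus>\<^bsub>gns_space d L\<^esub> B) C = 0))"

text \<open>
  The \<open>i\<close>-th multiplication operator on \<open>T\<^sub>L\<close>. Only representatives of degree at most \<open>d\<close> are used;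
  the projection does not depend on which of them is taken.
\<close>

definition gns_mult ::
    "enat \<Rightarrow> ('n::finite mpoly \<Rightarrow> real) \<Rightarrow> 'n \<Rightarrow> 'n mpoly set \<Rightarrow> 'n mpoly set" where
  "gns_mult d L i A = (\<Union>p \<in> A \<inter> polys d. gns_proj d L (gns_class d L (mvar i * p)))"

definition gns_mults_commute :: "enat \<Rightarrow> ('n::finite mpoly \<Rightarrow> real) \<Rightarrow> bool" where
  "gns_mults_commute d L \<longleftrightarrow>
     (\<forall>i j. \<forall>A\<in>gns_trunc d L.
        gns_mult d L i (gns_mult d L j A) = gns_mult d L j (gns_mult d L i A))"

definition quad_domain :: "enat \<Rightarrow> ('n::finite mpoly \<Rightarrow> real) \<Rightarrow> 'n mpoly set" where
  "quad_domain d L =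
     {\<Sum>i<s. p i * q i | (s::nat) p q.
        0 < s \<and>
        (\<forall>i<s. p i \<in> polys (d + 1) \<and> q i \<in> {a + u | a u. a \<in> polys d \<and> u \<in> gns_kernel d L})}"

definition quadrature_rule ::
    "('n::finite mpoly \<Rightarrow> real) \<Rightarrow> 'n mpoly set \<Rightarrow> (real ^ 'n) set \<Rightarrow> (real ^ 'n \<Rightarrow> real) \<Rightarrow> bool"
  where
  "quadrature_rule L U N w \<longleftrightarrow>
     finite N \<and> (\<forall>x\<in>N. 0 < w x) \<and> (\<forall>p\<in>U. L p = (\<Sum>x\<in>N. w x * meval p x))"

end

theory Submission
  imports Defs "HOL-Computational_Algebra.Fundamental_Theorem_Algebra"
begin

text \<open>
  By the positivity of \<open>L\<close>, \<open>(p, q) \<mapsto> L(p q)\<close> is a positive semidefinite form on the polynomials of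
  degree at most \<open>d + 1\<close> with null space \<open>U\<^sub>L\<close>. The space \<open>T\<^sub>L\<close> is finite-dimensional, and the operators
  \<open>M\<^sub>L\<^sub>,\<^sub>i\<close> on it are self-adjoint and commute. Hence \<open>T\<^sub>L\<close> has an orthonormal basis of joint eigenvectors,
  represented by polynomials \<open>g\<close> of degree at most \<open>d\<close>; the eigenvalues of \<open>g\<close> form a point
  \<open>y\<^sub>g\<close> of \<open>\<real>\<^sup>n\<close>. These points are the nodes, with the weights \<open>L(g)\<^sup>2\<close>.

  The eigenvector property says \<open>L(X\<^sub>i g q) = (y\<^sub>g)\<^sub>i L(g q)\<close> for \<open>q\<close> of degree at most \<open>d\<close>. Induction on
  the degree turns it into \<open>L(p g) = p(y\<^sub>g) L(g)\<close> for all \<open>p\<close> of degree at most \<open>d + 1\<close>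
  (\<open>eval_of_joint_eigenvector\<close>). With orthonormality this single relation yields that the weights are
  positive, that the nodes are pairwise distinct, that the elements of \<open>U\<^sub>L\<close> vanish at the nodes, and,
  by Parseval's identity, that the quadrature rule holds for products of a polynomial of degree at most
  \<open>d + 1\<close> with one of degree at most \<open>d\<close> (\<open>quadrature_of_joint_eigenbasis\<close>). The number of nodes is the
  size of an orthonormal basis of \<open>T\<^sub>L\<close> (\<open>dim_gns_trunc\<close>).

  The input from linear algebra is the simultaneous diagonalization of commuting self-adjoint operators
  (\<open>joint_eigenbasis_exists\<close>). It is proved on a subspace of a real vector space that carries a positive
  definite form: an annihilating real polynomial of a vector, factored by the fundamental theorem of
  algebra, produces an eigenvector, since an irreducible quadratic factor has an injective
  value at a self-adjoint operator. To apply it, \<open>T\<^sub>L\<close> is replaced by the span of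
  representatives of an orthonormal basis, which meets \<open>U\<^sub>L\<close> in \<open>0\<close>, so that the operators act on
  polynomials and not on classes
  (\<open>trunc_basis_exists\<close>, \<open>gns_mult_class\<close>).
\<close>

section \<open>Positive semidefinite forms\<close>

locale psd_form =
  fixes V :: "'a::real_vector set" and B :: "'a \<Rightarrow> 'a \<Rightarrow> real"
  assumes V: "Real_Vector_Spaces.subspace V"
    and add_left: "\<And>x y z. x \<in> V \<Longrightarrow> y \<in> V \<Longrightarrow> z \<in> V \<Longrightarrow> B (x + y) z = B x z + B y z"
    and scale_left: "\<And>c x z. x \<in> V \<Longrightarrow> z \<in> V \<Longrightarrow> B (c *\<^sub>R x) z = c * B x z"
    and form_sym: "\<And>x z. x \<in> V \<Longrightarrow> z \<in> V \<Longrightarrow> B x z = B z x"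
    and nonneg: "\<And>x. x \<in> V \<Longrightarrow> 0 \<le> B x x"
begin

lemmas V_closed = subspace_0[OF V] subspace_add[OF V] subspace_diff[OF V]
  subspace_scale[OF V] subspace_sum[OF V]

lemma add_right: "x \<in> V \<Longrightarrow> y \<in> V \<Longrightarrow> z \<in> V \<Longrightarrow> B z (x + y) = B z x + B z y"
  using add_left[of x y z] form_sym[of z "x + y"] form_sym[of z x] form_sym[of z y] V_closed by auto

lemma scale_right: "x \<in> V \<Longrightarrow> z \<in> V \<Longrightarrow> B z (c *\<^sub>R x) = c * B z x"
  using scale_left[of x z c] form_sym[of z "c *\<^sub>R x"] form_sym[of z x] V_closed by auto

lemma diff_left: "x \<in> V \<Longrightarrow> y \<in> V \<Longrightarrow> z \<in> V \<Longrightarrow> B (x - y) z = B x z - B y z"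
  using add_left[of "x - y" y z] V_closed by auto

lemma diff_right: "x \<in> V \<Longrightarrow> y \<in> V \<Longrightarrow> z \<in> V \<Longrightarrow> B z (x - y) = B z x - B z y"
  using add_right[of "x - y" y z] V_closed by auto

lemma zero_left: "z \<in> V \<Longrightarrow> B 0 z = 0"
  using scale_left[of 0 z 0] V_closed by auto

lemma sum_left:
  assumes "\<And>i. i \<in> I \<Longrightarrow> x i \<in> V" "z \<in> V"
  shows "B (\<Sum>i\<in>I. c i *\<^sub>R x i) z = (\<Sum>i\<in>I. c i * B (x i) z)"
proof (cases "finite I")
  case True
  then show ?thesis using assms
  proof (induction I rule: finite_induct)
    case empty
    then show ?case by (simp add: zero_left)
  next
    case (insert i I)
    have "(\<Sum>i\<in>I. c i *\<^sub>R x i) \<in> V" using insert.prems by (intro V_closed) auto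
    then show ?case using insert by (simp add: add_left scale_left V_closed)
  qed
qed (use assms in \<open>simp add: zero_left\<close>)

lemma sum_right:
  assumes "\<And>i. i \<in> I \<Longrightarrow> x i \<in> V" "z \<in> V"
  shows "B z (\<Sum>i\<in>I. c i *\<^sub>R x i) = (\<Sum>i\<in>I. c i * B z (x i))"
proof -
  have "(\<Sum>i\<in>I. c i *\<^sub>R x i) \<in> V" using assms by (intro V_closed) auto
  then have "B z (\<Sum>i\<in>I. c i *\<^sub>R x i) = (\<Sum>i\<in>I. c i * B (x i) z)"
    using assms by (simp add: form_sym[of z] sum_left)
  also have "\<dots> = (\<Sum>i\<in>I. c i * B z (x i))"
    using assms form_sym by (intro sum.cong) auto
  finally show ?thesis .
qed

text \<open>
  This is the degenerate case of the Cauchy--Schwarz inequality. If \<open>B x x = 0\<close>, then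
  \<open>t \<mapsto> B (y - t x) (y - t x) = B y y - 2 t B x y\<close> is an affine function of \<open>t\<close> that is bounded below,
  hence constant.
\<close>

lemma null_imp_orthogonal:
  assumes x: "x \<in> V" "B x x = 0" and y: "y \<in> V"
  shows "B x y = 0"
proof (rule ccontr)
  assume n: "B x y \<noteq> 0"
  \<comment> \<open>the parameter at which the affine function takes the value \<open>-1\<close>\<close>
  define t where "t = (B y y + 1) / (2 * B x y)"
  have "0 \<le> B (y - t *\<^sub>R x) (y - t *\<^sub>R x)"
    using x y by (intro nonneg V_closed) auto
  also have "\<dots> = B y y - 2 * t * B x y"
    using x y by (simp add: diff_left diff_right scale_left scale_right V_closed form_sym[of y x])
  also have "\<dots> = -1" using n by (simp add: t_def divide_simps)
  finally show False by simp
qed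

definition null_space :: "'a set" where
  "null_space = {x \<in> V. \<forall>y\<in>V. B x y = 0}"

lemma null_space_iff: "x \<in> null_space \<longleftrightarrow> x \<in> V \<and> B x x = 0"
  using null_imp_orthogonal by (auto simp: null_space_def)

lemma subspace_null_space: "Real_Vector_Spaces.subspace null_space"
  by (auto simp: null_space_def Real_Vector_Spaces.subspace_def
      zero_left add_left scale_left V_closed)

definition orthonormal :: "'a set \<Rightarrow> bool" where
  "orthonormal F \<longleftrightarrow> F \<subseteq> V \<and> finite F \<and> (\<forall>f\<in>F. \<forall>g\<in>F. B f g = (if f = g then 1 else 0))"

definition proj :: "'a set \<Rightarrow> 'a \<Rightarrow> 'a" where
  "proj F x = (\<Sum>f\<in>F. B x f *\<^sub>R f)"

lemma orthonormal_sum: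
  assumes F: "orthonormal F" and g: "g \<in> F"
  shows "B (\<Sum>f\<in>F. c f *\<^sub>R f) g = c g"
proof -
  have "B (\<Sum>f\<in>F. c f *\<^sub>R f) g = (\<Sum>f\<in>F. c f * B f g)"
    using F g by (intro sum_left) (auto simp: orthonormal_def)
  also have "\<dots> = (\<Sum>f\<in>F. if f = g then c g else 0)"
    using F g by (intro sum.cong) (auto simp: orthonormal_def)
  also have "\<dots> = c g" using F g by (simp add: orthonormal_def)
  finally show ?thesis .
qed

lemma proj_in_span: "proj F x \<in> span F"
  unfolding proj_def by (intro span_sum span_scale span_base)

lemma span_orthonormal_subset: "orthonormal F \<Longrightarrow> span F \<subseteq> V"
  using V by (intro span_minimal) (auto simp: orthonormal_def)

lemma proj_in_V: "orthonormal F \<Longrightarrow> proj F x \<in> V"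
  using proj_in_span span_orthonormal_subset by blast

lemma B_proj_basis: "orthonormal F \<Longrightarrow> g \<in> F \<Longrightarrow> B (proj F x) g = B x g"
  unfolding proj_def by (rule orthonormal_sum)

lemma span_orthonormal_repr:
  assumes F: "orthonormal F" and x: "x \<in> span F"
  shows "proj F x = x"
proof -
  obtain c where c: "x = (\<Sum>f\<in>F. c f *\<^sub>R f)"
    using x F by (auto simp: orthonormal_def span_finite)
  show ?thesis unfolding proj_def
    by (subst (2) c) (simp add: c orthonormal_sum[OF F])
qed

lemma B_proj:
  assumes F: "orthonormal F" and x: "x \<in> V" and y: "y \<in> span F"
  shows "B (proj F x) y = B x y"
proof -
  have FV: "f \<in> V" if "f \<in> F" for f using F that by (auto simp: orthonormal_def)
  have "B (proj F x) (proj F y) = B x (proj F y)"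
    unfolding proj_def[of F y] using FV x proj_in_V[OF F]
    by (simp add: sum_right B_proj_basis[OF F])
  then show ?thesis using span_orthonormal_repr[OF F y] by simp
qed

lemma proj_add:
  "orthonormal F \<Longrightarrow> x \<in> V \<Longrightarrow> y \<in> V \<Longrightarrow> proj F (x + y) = proj F x + proj F y"
  unfolding proj_def orthonormal_def sum.distrib[symmetric]
  by (intro sum.cong) (auto simp: add_left scaleR_add_left)

lemma proj_scale:
  "orthonormal F \<Longrightarrow> x \<in> V \<Longrightarrow> proj F (c *\<^sub>R x) = c *\<^sub>R proj F x"
  unfolding proj_def orthonormal_def scaleR_sum_right
  by (intro sum.cong) (auto simp: scale_left)

lemma orthonormal_independent:
  assumes F: "orthonormal F"
  shows "independent F"
proof
  assume "dependent F"
  then obtain u g where u: "g \<in> F" "u g \<noteq> 0" "(\<Sum>f\<in>F. u f *\<^sub>R f) = 0"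
    using F by (auto simp: dependent_finite orthonormal_def)
  have "u g = B (\<Sum>f\<in>F. u f *\<^sub>R f) g" using orthonormal_sum[OF F u(1)] by simp
  also have "\<dots> = 0" using u F zero_left by (auto simp: orthonormal_def)
  finally show False using u by simp
qed

text \<open>
  The expansion of a null vector in \<open>F\<close> has zero coefficients. So \<open>span F\<close> is a complement of the
  null space inside \<open>span F + null_space\<close>: computations with classes modulo the null space can be
  carried out with representatives from \<open>span F\<close>, where the form is positive definite.
\<close>

lemma span_definite:
  assumes F: "orthonormal F" and x: "x \<in> span F" "x \<in> null_space"
  shows "x = 0"
proof -
  have "proj F x = 0" unfolding proj_def
    using x F by (intro sum.neutral) (auto simp: null_space_def orthonormal_def)
  then show ?thesis using span_orthonormal_repr[OF F x(1)] by simp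
qed

lemma orthonormal_insert:
  assumes F: "orthonormal F" and x: "x \<in> V" "\<forall>f\<in>F. B x f = 0" "B x x \<noteq> 0"
  obtains c where "c \<noteq> 0" "orthonormal (insert (c *\<^sub>R x) F)" "c *\<^sub>R x \<notin> F"
proof -
  define c where "c = 1 / sqrt (B x x)"
  have p: "B x x > 0" using nonneg[OF x(1)] x(3) by simp
  have c: "c \<noteq> 0" "c * (c * B x x) = 1" using p by (auto simp: c_def)
  have *: "B (c *\<^sub>R x) (c *\<^sub>R x) = 1"
    using x c by (simp add: scale_left scale_right V_closed)
  have **: "B (c *\<^sub>R x) f = 0" "B f (c *\<^sub>R x) = 0" if "f \<in> F" for f
    using x F that form_sym[of f x] by (auto simp: scale_left scale_right orthonormal_def)
  have n: "c *\<^sub>R x \<notin> F" using * ** by force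
  have "orthonormal (insert (c *\<^sub>R x) F)"
    using F * ** n x by (auto simp: orthonormal_def V_closed)
  then show ?thesis using that c n by blast
qed

lemma diff_proj_orthogonal:
  assumes "orthonormal F" "x \<in> V" "f \<in> F"
  shows "B (x - proj F x) f = 0"
  using assms B_proj_basis[OF assms(1,3)] proj_in_V[OF assms(1)]
  by (auto simp: diff_left orthonormal_def)

text \<open>
  Gram--Schmidt orthonormalization for a form that may be degenerate: a vector whose residual has
  norm zero contributes no new element of \<open>F\<close>, and its residual is absorbed by the null space.
\<close>

lemma gram_schmidt:
  assumes "finite S" "S \<subseteq> V"
  shows "\<exists>F. orthonormal F \<and> F \<subseteq> span S \<and> (\<forall>s\<in>S. \<exists>f\<in>span F. s - f \<in> null_space)"
  using assms
proof (induction S rule: finite_induct)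
  case empty
  show ?case by (rule exI[of _ "{}"]) (simp add: orthonormal_def)
next
  case (insert s S)
  then obtain F where F: "orthonormal F" "F \<subseteq> span S" "\<forall>s\<in>S. \<exists>f\<in>span F. s - f \<in> null_space"
    by auto
  define r where "r = s - proj F s"
  have s: "s \<in> V" using insert by simp
  have r: "r \<in> V" unfolding r_def using s proj_in_V[OF F(1)] by (intro V_closed)
  have rF: "\<forall>f\<in>F. B r f = 0" unfolding r_def using diff_proj_orthogonal[OF F(1) s] by simp
  have spS: "span S \<subseteq> span (insert s S)" by (intro span_mono) auto
  have rS: "r \<in> span (insert s S)" unfolding r_def
    using proj_in_span[of F s] span_mono[OF F(2)] spS
    by (intro span_diff) (auto simp: span_span span_base)
  show ?case
  proof (cases "B r r = 0")
    case True
    then have "s - proj F s \<in> null_space" using r by (simp add: null_space_iff r_def)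
    then show ?thesis using F spS proj_in_span[of F s] by blast
  next
    case False
    then obtain c where c: "c \<noteq> 0" "orthonormal (insert (c *\<^sub>R r) F)"
      using orthonormal_insert[OF F(1) r rF] by blast
    let ?F = "insert (c *\<^sub>R r) F"
    have sub: "span F \<subseteq> span ?F" by (intro span_mono) auto
    have "(1 / c) *\<^sub>R (c *\<^sub>R r) \<in> span ?F" by (intro span_scale span_base) auto
    then have "r + proj F s \<in> span ?F"
      using c proj_in_span[of F s] sub by (intro span_add) auto
    then have "s \<in> span ?F" by (simp add: r_def)
    moreover have "0 \<in> null_space" using subspace_0[OF subspace_null_space] .
    ultimately have "\<exists>f\<in>span ?F. s - f \<in> null_space" by (intro bexI[of _ s]) auto
    moreover have "?F \<subseteq> span (insert s S)" using F(2) spS rS by (auto intro: span_scale)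
    ultimately show ?thesis using c(2) F(3) sub by (intro exI[of _ ?F]) blast
  qed
qed

end

section \<open>Commuting self-adjoint operators\<close>

lemma poly_map_of_real_of_real:
  "poly (map_poly of_real p) (of_real x) = (of_real (poly p x) :: complex)"
  by (induction p) (simp_all add: map_poly_pCons)

lemma poly_map_of_real_add:
  "poly (map_poly of_real (p + q)) z = poly (map_poly of_real p) z + (poly (map_poly of_real q) z :: complex)"
proof -
  have "map_poly of_real (p + q) = map_poly of_real p + (map_poly of_real q :: complex poly)"
    by (intro poly_eqI) (simp add: coeff_map_poly)
  then show ?thesis by simp
qed

lemma poly_map_of_real_mult:
  "poly (map_poly of_real (p * q)) z = poly (map_poly of_real p) z * (poly (map_poly of_real q) z :: complex)"
proof -
  have "map_poly of_real (p * q) = map_poly of_real p * (map_poly of_real q :: complex poly)"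
    by (intro poly_eqI) (simp add: coeff_map_poly coeff_mult)
  then show ?thesis by simp
qed

text \<open>
  The divisor is \<open>(X - z)(X - cnj z)\<close>. The remainder modulo it is a real polynomial of degree at most
  \<open>1\<close> with the nonreal root \<open>z\<close>, which forces it to vanish.
\<close>

lemma quadratic_dvd_of_complex_root:
  fixes p :: "real poly"
  assumes root: "poly (map_poly of_real p) z = 0" and im: "Im z \<noteq> 0"
  shows "[:(Re z)\<^sup>2 + (Im z)\<^sup>2, - 2 * Re z, 1:] dvd p" (is "?q dvd p")
proof -
  define r where "r = p mod ?q"
  have q0: "poly (map_poly of_real ?q) z = 0"
    by (simp add: map_poly_pCons complex_eq_iff power2_eq_square algebra_simps)
  have "p = ?q * (p div ?q) + r" unfolding r_def by (rule mult_div_mod_eq[symmetric])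
  then have rz: "poly (map_poly of_real r) z = 0"
    using root q0 by (metis add_0 mult_zero_left poly_map_of_real_add poly_map_of_real_mult)
  have "degree r < 2" unfolding r_def using degree_mod_less'[of ?q p] by (cases "p mod ?q = 0") auto
  then have "r = [:coeff r 0, coeff r 1:]"
    by (intro poly_eqI) (auto simp: coeff_pCons coeff_eq_0 split: nat.split)
  then obtain a b where r: "r = [:a, b:]" by blast
  have "b = 0" "a = 0" using rz im unfolding r by (auto simp: map_poly_pCons complex_eq_iff)
  then have "r = 0" using r by simp
  then show ?thesis unfolding r_def by (simp add: mod_eq_0_iff_dvd)
qed

text \<open>
  The relation is between the terms of a sequence and not between the elements of a set, since it
  will be applied to the iterates \<open>M\<^sup>i v\<close>, which may repeat.
\<close>

lemma linear_relation_exists: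
  fixes u :: "nat \<Rightarrow> 'a::real_vector"
  assumes S: "finite S" and u: "\<And>i. u i \<in> span S"
  obtains c k where "k \<le> card S" "c k \<noteq> 0" "(\<Sum>i\<le>card S. c i *\<^sub>R u i) = 0"
proof (cases "inj_on u {..card S}")
  case True
  have "dependent (u ` {..card S})"
  proof (rule ccontr)
    assume "independent (u ` {..card S})"
    then have "card (u ` {..card S}) \<le> card S"
      using independent_span_bound[OF S] u by blast
    then show False using True by (simp add: card_image)
  qed
  then obtain a where a: "\<exists>v\<in>u ` {..card S}. a v \<noteq> 0" "(\<Sum>v\<in>u ` {..card S}. a v *\<^sub>R v) = 0"
    by (subst (asm) dependent_finite) auto
  then obtain k where k: "k \<le> card S" "a (u k) \<noteq> 0" by auto
  show ?thesis
    using a True k by (intro that[of k "\<lambda>i. a (u i)"]) (auto simp: sum.reindex)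
next
  case False
  then obtain i j where ij: "i \<le> card S" "j \<le> card S" "i \<noteq> j" "u i = u j"
    by (auto simp: inj_on_def)
  let ?c = "\<lambda>k. if k = i then 1 else if k = j then -1 else 0 :: real"
  have "(\<Sum>k\<le>card S. ?c k *\<^sub>R u k) = (\<Sum>k\<in>{i, j}. ?c k *\<^sub>R u k)"
    using ij by (intro sum.mono_neutral_right) auto
  also have "\<dots> = 0" using ij by simp
  finally show ?thesis using ij by (intro that[of i ?c]) auto
qed

locale selfadjoint_on = psd_form V B
  for V :: "'a::real_vector set" and B :: "'a \<Rightarrow> 'a \<Rightarrow> real" +
  fixes M :: "'a \<Rightarrow> 'a"
  assumes M_closed: "\<And>x. x \<in> V \<Longrightarrow> M x \<in> V"
    and M_add: "\<And>x y. x \<in> V \<Longrightarrow> y \<in> V \<Longrightarrow> M (x + y) = M x + M y"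
    and M_scale: "\<And>c x. x \<in> V \<Longrightarrow> M (c *\<^sub>R x) = c *\<^sub>R M x"
    and M_selfadjoint: "\<And>x y. x \<in> V \<Longrightarrow> y \<in> V \<Longrightarrow> B (M x) y = B x (M y)"
    and definite: "\<And>x. x \<in> V \<Longrightarrow> B x x = 0 \<Longrightarrow> x = 0"
begin

lemma M_zero: "M 0 = 0"
  using M_scale[of 0 0] V_closed by simp

lemma M_diff: "x \<in> V \<Longrightarrow> y \<in> V \<Longrightarrow> M (x - y) = M x - M y"
  using M_add[of "x - y" y] V_closed by simp

text \<open>
  The value \<open>p(M) v\<close>. Horner's scheme is used because it recurses over \<open>pCons\<close>, so that additivity
  and multiplication by polynomials of low degree follow by induction over the coefficients.
\<close>

definition poly_op :: "real poly \<Rightarrow> 'a \<Rightarrow> 'a" where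
  "poly_op p v = fold_coeffs (\<lambda>a w. a *\<^sub>R v + M w) p 0"

lemma poly_op_0: "poly_op 0 v = 0"
  by (simp add: poly_op_def)

lemma poly_op_pCons: "poly_op (pCons a p) v = a *\<^sub>R v + M (poly_op p v)"
  by (cases "a = 0 \<and> p = 0") (auto simp: poly_op_def M_zero)

lemma poly_op_closed: "v \<in> V \<Longrightarrow> poly_op p v \<in> V"
  by (induction p) (auto simp: poly_op_0 poly_op_pCons intro!: V_closed M_closed)

lemma poly_op_add: "v \<in> V \<Longrightarrow> poly_op (p + q) v = poly_op p v + poly_op q v"
  by (induction p q rule: poly_induct2)
    (simp_all add: poly_op_0 poly_op_pCons M_add poly_op_closed scaleR_add_left)

lemma poly_op_smult: "v \<in> V \<Longrightarrow> poly_op (Polynomial.smult c p) v = c *\<^sub>R poly_op p v"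
  by (induction p)
    (simp_all add: poly_op_0 poly_op_pCons M_scale poly_op_closed scaleR_add_right)

lemma poly_op_diff: "v \<in> V \<Longrightarrow> poly_op (p - q) v = poly_op p v - poly_op q v"
  using poly_op_add[of v "p - q" q] by simp

lemma poly_op_monom: "v \<in> V \<Longrightarrow> poly_op (Polynomial.monom c k) v = c *\<^sub>R (M ^^ k) v \<and> (M ^^ k) v \<in> V"
  by (induction k)
    (auto simp: monom_0 monom_Suc poly_op_0 poly_op_pCons M_scale M_zero M_closed)

lemma poly_op_sum: "v \<in> V \<Longrightarrow> poly_op (\<Sum>i\<in>I. p i) v = (\<Sum>i\<in>I. poly_op (p i) v)"
  by (induction I rule: infinite_finite_induct) (auto simp: poly_op_0 poly_op_add)

text \<open>
  A real polynomial that annihilates a nonzero vector has a linear factor \<open>X - a\<close> whose value at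
  \<open>M\<close> is not injective: an irreducible quadratic factor \<open>(X - a)\<^sup>2 + b\<^sup>2\<close> has an injective value at
  \<open>M\<close>, because \<open>\<langle>((M - a)\<^sup>2 + b\<^sup>2) w, w\<rangle> = \<parallel>(M - a) w\<parallel>\<^sup>2 + b\<^sup>2 \<parallel>w\<parallel>\<^sup>2\<close>.
\<close>

lemma eigenvector_of_annihilator:
  assumes "v \<in> V" "v \<noteq> 0" "p \<noteq> 0" "poly_op p v = 0"
    and W: "Real_Vector_Spaces.subspace W" "W \<subseteq> V" "\<And>x. x \<in> W \<Longrightarrow> M x \<in> W" "v \<in> W"
  shows "\<exists>a. \<exists>w\<in>W. w \<noteq> 0 \<and> M w = a *\<^sub>R w"
  using assms(3,4)
proof (induction "degree p" arbitrary: p rule: less_induct)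
  case less
  have poly_op_W: "poly_op q v \<in> W" for q
    by (induction q) (auto simp: poly_op_0 poly_op_pCons
        intro!: subspace_add[OF W(1)] subspace_scale[OF W(1)] subspace_0[OF W(1)] W(3,4))
  have "degree p \<noteq> 0"
  proof
    assume "degree p = 0"
    then obtain c where c: "p = [:c:]" by (metis degree_eq_zeroE)
    then have "c *\<^sub>R v = 0" using less.prems by (simp add: poly_op_pCons poly_op_0 M_zero)
    then show False using c less.prems assms(2) by simp
  qed
  then have "\<not> constant (poly (map_poly complex_of_real p))"
    by (simp add: constant_degree degree_map_poly)
  then obtain z where z: "poly (map_poly complex_of_real p) z = 0"
    using fundamental_theorem_of_algebra by blast
  show ?case
  proof (cases "Im z = 0")
    case True
    then have "z = of_real (Re z)" by (simp add: complex_eq_iff)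
    \<comment> \<open>a real root: either the cofactor already annihilates \<open>v\<close>, or its value at \<open>v\<close> is an eigenvector\<close>
    then have "of_real (poly p (Re z)) = (0::complex)" using z by (metis poly_map_of_real_of_real)
    then obtain q where q: "p = [:- Re z, 1:] * q"
      using poly_eq_0_iff_dvd[of p "Re z"] by (auto elim: dvdE)
    then have q0: "q \<noteq> 0" using less.prems by auto
    let ?w = "poly_op q v"
    have "poly_op p v = (- Re z) *\<^sub>R ?w + M ?w"
      unfolding q using assms(1)
      by (simp add: poly_op_diff poly_op_smult poly_op_pCons)
    then have ev: "M ?w = Re z *\<^sub>R ?w" using less.prems by (simp add: eq_neg_iff_add_eq_0 add.commute)
    show ?thesis
    proof (cases "?w = 0")
      case True
      have "degree q < degree p" unfolding q using q0 by (subst degree_mult_eq) auto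
      then show ?thesis using less.hyps q0 True by blast
    qed (use ev poly_op_W in blast)
  next
    case False
    define a b where "a = Re z" and "b = Im z"
    obtain q where q: "p = [:a\<^sup>2 + b\<^sup>2, - 2 * a, 1:] * q"
      using quadratic_dvd_of_complex_root[OF z False] by (auto simp: a_def b_def elim: dvdE)
    then have q0: "q \<noteq> 0" using less.prems by auto
    define w where "w = poly_op q v"
    have w: "w \<in> V" unfolding w_def using assms(1) by (rule poly_op_closed)
    \<comment> \<open>\<open>0 = p(M) v = (M - a)\<^sup>2 w + b\<^sup>2 w\<close>, and pairing with \<open>w\<close> shows \<open>w = 0\<close>\<close>
    define t where "t = M w - a *\<^sub>R w"
    have t: "t \<in> V" unfolding t_def using w by (intro V_closed M_closed)
    have two: "(2 * a) *\<^sub>R x = a *\<^sub>R x + a *\<^sub>R x" for x :: 'a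
      by (metis mult_2 scaleR_add_left)
    have "poly_op p v = (a\<^sup>2 + b\<^sup>2) *\<^sub>R w + M ((- 2 * a) *\<^sub>R w + M w)"
      unfolding q w_def using assms(1)
      by (simp add: poly_op_add poly_op_diff poly_op_smult poly_op_pCons V_closed M_closed poly_op_closed)
    also have "\<dots> = (M t - a *\<^sub>R t) + b\<^sup>2 *\<^sub>R w"
      unfolding t_def using w
      by (simp add: M_add M_scale M_diff V_closed M_closed scaleR_diff_right scaleR_add_left
          power2_eq_square) (simp add: two)
    finally have "B ((M t - a *\<^sub>R t) + b\<^sup>2 *\<^sub>R w) w = 0"
      using less.prems zero_left[OF w] by simp
    also have "B ((M t - a *\<^sub>R t) + b\<^sup>2 *\<^sub>R w) w = B t t + b\<^sup>2 * B w w"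
    proof -
      have "B ((M t - a *\<^sub>R t) + b\<^sup>2 *\<^sub>R w) w = B t (M w) - a * B t w + b\<^sup>2 * B w w"
        using w t by (simp add: add_left diff_left scale_left V_closed M_closed M_selfadjoint)
      also have "B t (M w) - a * B t w = B t t"
        using w t diff_right[of "M w" "a *\<^sub>R w" t]
        by (simp add: t_def[symmetric] scale_right V_closed M_closed)
      finally show ?thesis .
    qed
    finally have "b\<^sup>2 * B w w = 0"
      using nonneg[OF t] nonneg[OF w] by (smt (verit) mult_nonneg_nonneg zero_le_power2)
    then have "w = 0" using False definite[OF w] by (simp add: b_def)
    moreover have "degree q < degree p" unfolding q using q0 by (subst degree_mult_eq) auto
    ultimately show ?thesis using less.hyps[of q] q0 by (simp add: w_def)
  qed
qed

text \<open>
  In finite dimension the iterates \<open>v, M v, M\<^sup>2 v, \<dots>\<close> satisfy a linear relation, which is an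
  annihilating polynomial for \<open>v\<close>.
\<close>

lemma eigenvector_exists:
  assumes S: "finite S" "V \<subseteq> span S"
    and W: "Real_Vector_Spaces.subspace W" "W \<subseteq> V" "\<And>x. x \<in> W \<Longrightarrow> M x \<in> W" "v \<in> W" "v \<noteq> 0"
  shows "\<exists>a. \<exists>w\<in>W. w \<noteq> 0 \<and> M w = a *\<^sub>R w"
proof -
  have v: "v \<in> V" using W by auto
  have "(M ^^ i) v \<in> span S" for i using poly_op_monom[OF v, of 0 i] S by auto
  then obtain c k where c: "k \<le> card S" "c k \<noteq> 0" "(\<Sum>i\<le>card S. c i *\<^sub>R (M ^^ i) v) = 0"
    by (rule linear_relation_exists[OF S(1)])
  define p where "p = (\<Sum>i\<le>card S. Polynomial.monom (c i) i)"
  have "coeff p k = c k" using c by (simp add: p_def coeff_sum)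
  then have "p \<noteq> 0" using c by auto
  moreover have "poly_op p v = 0"
    using c(3) v by (simp add: p_def poly_op_sum poly_op_monom)
  ultimately show ?thesis using eigenvector_of_annihilator[OF v W(5) _ _ W(1-4)] by blast
qed

end

locale commuting_selfadjoint_on =
  fixes V :: "'a::real_vector set" and B :: "'a \<Rightarrow> 'a \<Rightarrow> real" and M :: "'i::finite \<Rightarrow> 'a \<Rightarrow> 'a"
  assumes selfadjoint: "\<And>i. selfadjoint_on V B (M i)"
    and commute: "\<And>i j x. x \<in> V \<Longrightarrow> M i (M j x) = M j (M i x)"
    and finite_dim: "\<exists>S. finite S \<and> V \<subseteq> span S"
begin

sublocale psd_form V B
  using selfadjoint by (auto simp: selfadjoint_on_def)

text \<open>
  An eigenspace of one operator is invariant under the operators that commute with it, so the index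
  set can be treated one element at a time.
\<close>

lemma joint_eigenvector_exists:
  assumes "finite I" "Real_Vector_Spaces.subspace W" "W \<subseteq> V" "\<And>i x. x \<in> W \<Longrightarrow> M i x \<in> W" "W \<noteq> {0}"
  shows "\<exists>y. \<exists>w\<in>W. w \<noteq> 0 \<and> (\<forall>i\<in>I. M i w = y i *\<^sub>R w)"
  using assms
proof (induction I arbitrary: W rule: finite_induct)
  case empty
  then show ?case using subspace_0 by fastforce
next
  case (insert j I)
  interpret Mj: selfadjoint_on V B "M j" by (rule selfadjoint)
  obtain v where v: "v \<in> W" "v \<noteq> 0" using insert.prems subspace_0 by fastforce
  obtain S where S: "finite S" "V \<subseteq> span S" using finite_dim by auto
  obtain a u where u: "u \<in> W" "u \<noteq> 0" "M j u = a *\<^sub>R u"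
    using Mj.eigenvector_exists[OF S insert.prems(1,2,3) v] by auto
  let ?W = "{w \<in> W. M j w = a *\<^sub>R w}"
  have "Real_Vector_Spaces.subspace ?W"
    unfolding Real_Vector_Spaces.subspace_def
    using insert.prems(2) subspace_0[OF insert.prems(1)] subspace_add[OF insert.prems(1)]
      subspace_scale[OF insert.prems(1)]
    by (auto simp: Mj.M_zero Mj.M_add Mj.M_scale subset_iff scaleR_add_right)
  moreover have "M i x \<in> ?W" if "x \<in> ?W" for i x
  proof -
    interpret Mi: selfadjoint_on V B "M i" by (rule selfadjoint)
    have x: "x \<in> V" using that insert.prems(2) by auto
    show ?thesis using that commute[OF x, of j i] insert.prems(3) x by (auto simp: Mi.M_scale)
  qed
  ultimately have "\<exists>y. \<exists>w\<in>?W. w \<noteq> 0 \<and> (\<forall>i\<in>I. M i w = y i *\<^sub>R w)"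
    using insert.prems(2) u by (intro insert.IH) auto
  then obtain y w where "w \<in> W" "w \<noteq> 0" "M j w = a *\<^sub>R w" "\<forall>i\<in>I. M i w = y i *\<^sub>R w" by auto
  then show ?case using insert.hyps
    by (intro exI[of _ "y(j := a)"] bexI[of _ w]) auto
qed

text \<open>
  A maximal orthonormal set \<open>F\<close> of joint eigenvectors spans \<open>V\<close>: by self-adjointness its orthogonal
  complement \<open>W\<close> is invariant, so a nonzero \<open>W\<close> would contain a further joint eigenvector. A maximal
  set exists because orthonormal sets are independent and \<open>V\<close> is finite-dimensional.
\<close>

theorem joint_eigenbasis_exists:
  obtains F y where "orthonormal F" "span F = V" "\<And>f i. f \<in> F \<Longrightarrow> M i f = y f i *\<^sub>R f"
proof -
  obtain S where S: "finite S" "V \<subseteq> span S" using finite_dim by auto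
  define P where "P F \<longleftrightarrow> orthonormal F \<and> (\<forall>f\<in>F. \<exists>a. \<forall>i. M i f = a i *\<^sub>R f)" for F
  have "P {}" by (simp add: P_def orthonormal_def)
  moreover have "card F < Suc (card S)" if "P F" for F
  proof -
    have F: "orthonormal F" using that by (simp add: P_def)
    then have "F \<subseteq> span S" using S(2) by (auto simp: orthonormal_def)
    then show ?thesis
      using independent_span_bound[OF S(1) orthonormal_independent[OF F]] by simp
  qed
  ultimately obtain F where F: "P F" "\<And>G. P G \<Longrightarrow> card G \<le> card F"
    using ex_has_greatest_nat[of P "{}" card "Suc (card S)"] by metis
  have on: "orthonormal F" using F by (simp add: P_def)
  have FV: "F \<subseteq> V" "finite F" using on by (auto simp: orthonormal_def)
  define W where "W = {w \<in> V. \<forall>f\<in>F. B w f = 0}"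
  have W: "Real_Vector_Spaces.subspace W"
    unfolding W_def Real_Vector_Spaces.subspace_def using FV
    by (auto simp: V_closed zero_left add_left scale_left subset_iff)
  have inv: "M i x \<in> W" if "x \<in> W" for i x
  proof -
    interpret Mi: selfadjoint_on V B "M i" by (rule selfadjoint)
    have "B (M i x) f = 0" if f: "f \<in> F" for f
    proof -
      obtain a where "\<And>i. M i f = a i *\<^sub>R f" using F(1) f by (auto simp: P_def)
      then show ?thesis using \<open>x \<in> W\<close> f FV by (auto simp: Mi.M_selfadjoint W_def scale_right)
    qed
    then show ?thesis using that Mi.M_closed by (auto simp: W_def)
  qed
  have W0: "W = {0}"
  proof (rule ccontr)
    assume "W \<noteq> {0}"
    then obtain y w where w: "w \<in> W" "w \<noteq> 0" "\<And>i. M i w = y i *\<^sub>R w"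
      using joint_eigenvector_exists[OF finite_class.finite_UNIV W _ inv] by (auto simp: W_def)
    have wV: "w \<in> V" "\<forall>f\<in>F. B w f = 0" using w by (auto simp: W_def)
    moreover have "B w w \<noteq> 0" using selfadjoint_on.definite[OF selfadjoint wV(1)] w(2) by auto
    ultimately obtain c where c: "orthonormal (insert (c *\<^sub>R w) F)" "c *\<^sub>R w \<notin> F"
      using orthonormal_insert[OF on] by metis
    have "M i (c *\<^sub>R w) = y i *\<^sub>R (c *\<^sub>R w)" for i
      using selfadjoint_on.M_scale[OF selfadjoint wV(1)] w(3) by simp
    then have "P (insert (c *\<^sub>R w) F)" using F(1) c by (auto simp: P_def)
    then have "card (insert (c *\<^sub>R w) F) \<le> card F" by (rule F(2))
    then show False using c FV by simp
  qed
  have "V \<subseteq> span F"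
  proof
    fix x assume x: "x \<in> V"
    then have "x - proj F x \<in> W"
      using diff_proj_orthogonal[OF on x] proj_in_V[OF on] by (auto simp: W_def V_closed)
    then have "x = proj F x" using W0 by simp
    then show "x \<in> span F" using proj_in_span by metis
  qed
  then have "span F = V" using span_orthonormal_subset[OF on] by blast
  moreover obtain y where "\<forall>f\<in>F. \<forall>i. M i f = y f i *\<^sub>R f"
    using F(1) unfolding P_def by metis
  ultimately show ?thesis using that on by blast
qed

end

section \<open>Real polynomials in several variables\<close>

text \<open>
  The instance gives access to \<open>span\<close>, linear independence and the results above for polynomials;
  \<open>mconst_mult\<close> below identifies the scalar multiplication with multiplication by constants.
\<close>

instantiation poly_mapping :: (type, real_vector) real_vector
begin

definition scaleR_poly_mapping :: "real \<Rightarrow> ('a \<Rightarrow>\<^sub>0 'b) \<Rightarrow> 'a \<Rightarrow>\<^sub>0 'b" where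
  "scaleR_poly_mapping c = Poly_Mapping.map (scaleR c)"

lemma lookup_scaleR [simp]:
  fixes p :: "'a \<Rightarrow>\<^sub>0 'b::real_vector"
  shows "Poly_Mapping.lookup (c *\<^sub>R p) m = c *\<^sub>R Poly_Mapping.lookup p m"
  by (simp add: scaleR_poly_mapping_def Poly_Mapping.map.rep_eq when_def)

instance
  by standard (auto intro!: poly_mapping_eqI simp: lookup_add scaleR_add_right scaleR_add_left)

end

lemma mconst_mult: "mconst c * p = c *\<^sub>R p"
proof -
  have "scaleR c = (*) c" by (intro ext) simp
  then show ?thesis
    by (simp add: mconst_def scaleR_poly_mapping_def mult_map_scale_conv_mult)
qed

lemma scaleR_mult_left: "(c *\<^sub>R p) * q = c *\<^sub>R (p * q :: 'n mpoly)"
  by (simp add: mconst_mult[symmetric] mult.assoc)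

lemma scaleR_mult_right: "p * (c *\<^sub>R q) = c *\<^sub>R (p * q :: 'n mpoly)"
  by (simp add: mconst_mult[symmetric] mult.left_commute)

abbreviation monomial :: "('n \<Rightarrow>\<^sub>0 nat) \<Rightarrow> 'n mpoly" where
  "monomial m \<equiv> Poly_Mapping.single m 1"

lemma sum_monomials:
  fixes p :: "'n mpoly"
  shows "p = (\<Sum>m\<in>Poly_Mapping.keys p. Poly_Mapping.lookup p m *\<^sub>R monomial m)"
  by (intro poly_mapping_eqI) (simp add: lookup_sum lookup_single when_def in_keys_iff if_distrib[of "\<lambda>x. _ * x"] cong: if_cong)

lemma monom_degree_add: "monom_degree (m + m') = monom_degree m + monom_degree m'"
  by (simp add: monom_degree_def lookup_add sum.distrib)

lemma monom_degree_single: "monom_degree (Poly_Mapping.single i k) = k"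
  by (simp add: monom_degree_def lookup_single when_def)

lemma keys_scaleR_subset: "Poly_Mapping.keys (c *\<^sub>R p) \<subseteq> Poly_Mapping.keys (p :: 'a \<Rightarrow>\<^sub>0 'b::real_vector)"
  by (auto simp: in_keys_iff)

lemma subspace_polys: "Real_Vector_Spaces.subspace (polys k)"
  unfolding Real_Vector_Spaces.subspace_def polys_def
  using Poly_Mapping.keys_add keys_scaleR_subset by (fastforce simp: subset_iff)

lemma polys_mono: "k \<le> l \<Longrightarrow> polys k \<subseteq> polys l"
  by (auto simp: polys_def)

lemma polys_mult: "p \<in> polys k \<Longrightarrow> q \<in> polys l \<Longrightarrow> p * q \<in> polys (k + l)"
  unfolding polys_def
proof safe
  fix m assume p: "\<forall>m\<in>Poly_Mapping.keys p. enat (monom_degree m) \<le> k"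
    and q: "\<forall>m\<in>Poly_Mapping.keys q. enat (monom_degree m) \<le> l"
    and "m \<in> Poly_Mapping.keys (p * q)"
  then obtain a b where "m = a + b" "a \<in> Poly_Mapping.keys p" "b \<in> Poly_Mapping.keys q"
    using keys_mult[of p q] by auto
  then show "enat (monom_degree m) \<le> k + l"
    using p q add_mono[of "enat (monom_degree a)" k "enat (monom_degree b)" l]
    by (simp add: monom_degree_add)
qed

lemma monomial_in_polys: "enat (monom_degree m) \<le> k \<Longrightarrow> monomial m \<in> polys k"
  by (auto simp: polys_def)

lemma mvar_in_polys: "mvar i \<in> polys 1"
  unfolding mvar_def by (intro monomial_in_polys) (simp add: monom_degree_single one_enat_def)

lemma finite_monomials: "finite {m :: 'n::finite \<Rightarrow>\<^sub>0 nat. monom_degree m \<le> k}"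
proof -
  have "Poly_Mapping.lookup ` {m :: 'n \<Rightarrow>\<^sub>0 nat. monom_degree m \<le> k} \<subseteq> (UNIV :: 'n set) \<rightarrow>\<^sub>E {..k}"
  proof safe
    fix m :: "'n \<Rightarrow>\<^sub>0 nat" and i :: 'n
    assume "monom_degree m \<le> k"
    moreover have "Poly_Mapping.lookup m i \<le> monom_degree m"
      unfolding monom_degree_def by (intro member_le_sum) auto
    ultimately show "Poly_Mapping.lookup m i \<le> k" by simp
  qed auto
  then have "finite (Poly_Mapping.lookup ` {m :: 'n \<Rightarrow>\<^sub>0 nat. monom_degree m \<le> k})"
    by (rule finite_subset) (intro finite_PiE; simp)
  then show ?thesis by (rule finite_imageD) (simp add: inj_on_def lookup_inject)
qed

lemma polys_enat_finite_span:
  "\<exists>S. finite S \<and> S \<subseteq> polys (enat k) \<and> polys (enat k) \<subseteq> span (S :: 'n::finite mpoly set)"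
proof (intro exI[of _ "monomial ` {m :: 'n \<Rightarrow>\<^sub>0 nat. monom_degree m \<le> k}"] conjI)
  show "polys (enat k) \<subseteq> span (monomial ` {m :: 'n \<Rightarrow>\<^sub>0 nat. monom_degree m \<le> k})"
  proof
    fix p :: "'n mpoly" assume p: "p \<in> polys (enat k)"
    have "(\<Sum>m\<in>Poly_Mapping.keys p. Poly_Mapping.lookup p m *\<^sub>R monomial m)
        \<in> span (monomial ` {m. monom_degree m \<le> k})"
      using p by (intro span_sum span_scale span_base) (auto simp: polys_def)
    then show "p \<in> span (monomial ` {m. monom_degree m \<le> k})"
      by (simp only: sum_monomials[symmetric])
  qed
qed (auto intro!: monomial_in_polys finite_monomials)

lemma meval_superset:
  assumes "finite K" "Poly_Mapping.keys p \<subseteq> K"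
  shows "meval p x = (\<Sum>m\<in>K. Poly_Mapping.lookup p m * (\<Prod>i\<in>UNIV. (x $ i) ^ Poly_Mapping.lookup m i))"
  unfolding meval_def using assms by (intro sum.mono_neutral_left) (auto simp: in_keys_iff)

lemma meval_add: "meval (p + q) x = meval p x + meval q x"
proof -
  let ?K = "Poly_Mapping.keys p \<union> Poly_Mapping.keys q"
  have "Poly_Mapping.keys (p + q) \<subseteq> ?K" by (rule Poly_Mapping.keys_add)
  then show ?thesis
    by (simp add: meval_superset[of ?K] lookup_add distrib_right sum.distrib)
qed

lemma meval_scaleR: "meval (c *\<^sub>R p) x = c * meval p x"
  using keys_scaleR_subset[of c p]
  by (simp add: meval_superset[of "Poly_Mapping.keys p"] sum_distrib_left mult.assoc)

lemma meval_0: "meval 0 x = 0"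
  by (simp add: meval_def)

lemma meval_sum: "meval (\<Sum>i\<in>I. p i) x = (\<Sum>i\<in>I. meval (p i) x)"
  by (induction I rule: infinite_finite_induct) (simp_all add: meval_0 meval_add)

lemma meval_monomial: "meval (monomial m) x = (\<Prod>i\<in>UNIV. (x $ i) ^ Poly_Mapping.lookup m i)"
  by (simp add: meval_def)

lemma meval_monomial_add: "meval (monomial (m + m')) x = meval (monomial m) x * meval (monomial m') x"
  by (simp add: meval_monomial lookup_add power_add prod.distrib)

lemma meval_mult: "meval (p * q) x = meval p x * meval q x"
proof -
  have "p * q = (\<Sum>m\<in>Poly_Mapping.keys p. \<Sum>m'\<in>Poly_Mapping.keys q.
      (Poly_Mapping.lookup p m * Poly_Mapping.lookup q m') *\<^sub>R monomial (m + m'))"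
    using arg_cong2[OF sum_monomials[of p] sum_monomials[of q], of "(*)"]
    by (simp add: sum_product scaleR_mult_left scaleR_mult_right mult_single mult.commute)
  moreover have "meval p x * meval q x = (\<Sum>m\<in>Poly_Mapping.keys p. \<Sum>m'\<in>Poly_Mapping.keys q.
      (Poly_Mapping.lookup p m * Poly_Mapping.lookup q m') * meval (monomial (m + m')) x)"
    by (simp add: meval_def[of p] meval_def[of q] sum_product meval_monomial[symmetric]
        meval_monomial_add mult_ac)
  ultimately show ?thesis by (simp add: meval_sum meval_scaleR)
qed

lemma meval_mvar: "meval (mvar i) x = x $ i"
proof -
  have "meval (mvar i) x = (\<Prod>j\<in>UNIV. if j = i then x $ i else 1)"
    unfolding mvar_def meval_monomial
    by (intro prod.cong) (auto simp: lookup_single when_def)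
  then show ?thesis by simp
qed

text \<open>The step by which statements about evaluation are proved by induction on the degree.\<close>

lemma monomial_split:
  assumes "m \<noteq> (0 :: 'n::finite \<Rightarrow>\<^sub>0 nat)"
  obtains i m' where "monomial m = mvar i * monomial m'" "monom_degree m = Suc (monom_degree m')"
proof -
  obtain i where i: "Poly_Mapping.lookup m i \<noteq> 0"
    using assms by (metis lookup_zero poly_mapping_eqI)
  define m' where "m' = m - Poly_Mapping.single i 1"
  have m: "m = Poly_Mapping.single i 1 + m'"
    unfolding m'_def using i
    by (intro poly_mapping_eqI) (auto simp: lookup_add lookup_minus lookup_single when_def)
  show ?thesis
    using that[of i m'] by (simp add: m mvar_def mult_single monom_degree_add monom_degree_single)
qed

section \<open>The GNS construction\<close>

locale gns_form =
  fixes d :: enat and L :: "'n::finite mpoly \<Rightarrow> real"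
  assumes lin: "linear_form (2 * d + 2) L"
    and pos: "L ` sums_of_squares (d + 1) \<subseteq> {0..}"
begin

lemma polys_le: "polys d \<subseteq> polys (d + 1)"
  by (intro polys_mono) simp

lemma mult_closed: "p \<in> polys (d + 1) \<Longrightarrow> q \<in> polys (d + 1) \<Longrightarrow> p * q \<in> polys (2 * d + 2)"
proof -
  have "d + 1 + (d + 1) = 2 * d + 2"
    by (cases d) (simp_all add: one_enat_def numeral_eq_enat)
  then show "p \<in> polys (d + 1) \<Longrightarrow> q \<in> polys (d + 1) \<Longrightarrow> p * q \<in> polys (2 * d + 2)"
    using polys_mult[of p "d + 1" q "d + 1"] by simp
qed

text \<open>
  The null space of this form is \<open>gns_kernel d L\<close>, so that the quotient in the GNS construction is
  the one by the null vectors of a positive semidefinite form.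
\<close>

sublocale psd_form "polys (d + 1)" "\<lambda>p q. L (p * q)"
proof
  fix p q r :: "'n mpoly" and c :: real
  assume p: "p \<in> polys (d + 1)" and r: "r \<in> polys (d + 1)"
  show "L ((c *\<^sub>R p) * r) = c * L (p * r)"
    using lin mult_closed[OF p r]
    by (simp add: linear_form_def scaleR_mult_left mconst_mult)
  assume q: "q \<in> polys (d + 1)"
  show "L ((p + q) * r) = L (p * r) + L (q * r)"
    using lin mult_closed[OF p r] mult_closed[OF q r] by (simp add: linear_form_def distrib_right)
next
  fix p :: "'n mpoly" assume p: "p \<in> polys (d + 1)"
  have "p * p \<in> sums_of_squares (d + 1)"
    unfolding sums_of_squares_def using p
    by (intro CollectI exI[of _ "1::nat"] exI[of _ "\<lambda>_. p"]) (simp add: power2_eq_square)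
  then show "0 \<le> L (p * p)" using pos by auto
qed (simp_all add: subspace_polys mult.commute)

lemma null_space_eq: "null_space = gns_kernel d L"
  by (simp add: null_space_def gns_kernel_def)

lemmas null_closed = subspace_0[OF subspace_null_space] subspace_add[OF subspace_null_space]
  subspace_diff[OF subspace_null_space] subspace_scale[OF subspace_null_space]

lemma mem_gns_class:
  "p \<in> polys (d + 1) \<Longrightarrow> q \<in> gns_class d L p \<longleftrightarrow> q \<in> polys (d + 1) \<and> p - q \<in> null_space"
  by (auto simp: gns_class_def gns_rel_def null_space_eq)

lemma gns_class_self: "p \<in> polys (d + 1) \<Longrightarrow> p \<in> gns_class d L p"
  using null_closed(1) by (simp add: mem_gns_class)

lemma gns_class_eq_iff:
  assumes p: "p \<in> polys (d + 1)" and q: "q \<in> polys (d + 1)"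
  shows "gns_class d L p = gns_class d L q \<longleftrightarrow> p - q \<in> null_space"
proof
  assume "gns_class d L p = gns_class d L q"
  then show "p - q \<in> null_space" using gns_class_self[OF q] by (metis mem_gns_class p)
next
  assume pq: "p - q \<in> null_space"
  have "p - r \<in> null_space \<longleftrightarrow> q - r \<in> null_space" for r
    using null_closed(2)[OF pq, of "q - r"] null_closed(3)[of "p - r", OF _ pq] by auto
  then show "gns_class d L p = gns_class d L q"
    using p q by (auto simp: mem_gns_class)
qed

lemma gns_add:
  assumes p: "p \<in> polys (d + 1)" and q: "q \<in> polys (d + 1)"
  shows "gns_class d L p \<oplus>\<^bsub>gns_space d L\<^esub> gns_class d L q = gns_class d L (p + q)"
proof -
  have *: "gns_class d L (p' + q') = gns_class d L (p + q)"
    if "p' \<in> gns_class d L p" "q' \<in> gns_class d L q" for p' q'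
  proof -
    have "(p - p') + (q - q') \<in> null_space" using that p q by (auto simp: mem_gns_class intro: null_closed)
    moreover have "(p - p') + (q - q') = (p + q) - (p' + q')" by simp
    ultimately have "(p + q) - (p' + q') \<in> null_space" by metis
    then show ?thesis using that p q gns_class_eq_iff[of "p + q" "p' + q'"]
      by (simp add: V_closed mem_gns_class)
  qed
  have "(\<Union>p'\<in>gns_class d L p. \<Union>q'\<in>gns_class d L q. gns_class d L (p' + q'))
      = gns_class d L (p + q)"
    by (intro SUP_eq_const *) (use gns_class_self[OF p] gns_class_self[OF q] in blast)+
  then show ?thesis by (simp add: gns_space_def)
qed

lemma gns_smult:
  assumes p: "p \<in> polys (d + 1)"
  shows "c \<odot>\<^bsub>gns_space d L\<^esub> gns_class d L p = gns_class d L (c *\<^sub>R p)"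
proof -
  have *: "gns_class d L (c *\<^sub>R p') = gns_class d L (c *\<^sub>R p)" if "p' \<in> gns_class d L p" for p'
  proof -
    have "c *\<^sub>R (p - p') \<in> null_space" using that p by (auto simp: mem_gns_class intro: null_closed)
    then show ?thesis using that p gns_class_eq_iff[of "c *\<^sub>R p" "c *\<^sub>R p'"]
      by (simp add: V_closed mem_gns_class scaleR_diff_right)
  qed
  have "(\<Union>p'\<in>gns_class d L p. gns_class d L (c *\<^sub>R p')) = gns_class d L (c *\<^sub>R p)"
    by (intro SUP_eq_const *) (use gns_class_self[OF p] in blast)+
  then show ?thesis by (simp add: gns_space_def mconst_mult)
qed

lemma gns_zero: "\<zero>\<^bsub>gns_space d L\<^esub> = gns_class d L 0"
  by (simp add: gns_space_def)

lemma gns_space_carrier: "gns_space d L = gns_space d L\<lparr>carrier := gns_class d L ` polys (d + 1)\<rparr>"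
  by (auto simp: gns_space_def quotient_def gns_class_def)

lemma vectorspace_gns_classes:
  assumes P: "Real_Vector_Spaces.subspace P" "P \<subseteq> polys (d + 1)"
  shows "vectorspace class_ring (gns_space d L\<lparr>carrier := gns_class d L ` P\<rparr>)" (is "vectorspace _ ?G")
proof -
  note P_closed = subspace_0[OF P(1)] subspace_add[OF P(1)] subspace_scale[OF P(1)]
  have PV: "p \<in> polys (d + 1)" if "p \<in> P" for p using P that by auto
  have "abelian_group ?G"
  proof (rule abelian_groupI)
    fix A assume "A \<in> carrier ?G"
    then obtain p where p: "p \<in> P" "A = gns_class d L p" by auto
    have mp: "- p \<in> P" using P_closed(3)[OF p(1), of "-1"] by simp
    have "gns_class d L (- p) \<oplus>\<^bsub>?G\<^esub> A = \<zero>\<^bsub>?G\<^esub>"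
      using gns_add[OF PV[OF mp] PV[OF p(1)]] p by (simp add: gns_zero)
    then show "\<exists>C\<in>carrier ?G. C \<oplus>\<^bsub>?G\<^esub> A = \<zero>\<^bsub>?G\<^esub>"
      using mp by auto
  qed (use PV P_closed in \<open>auto simp: gns_add gns_zero V_closed add_ac\<close>)
  then have "Module.module class_ring ?G"
    using PV P_closed
    by (intro Module.moduleI class_cring.is_cring)
      (auto simp: gns_add gns_smult V_closed scaleR_add_left scaleR_add_right)
  then show ?thesis by (intro vectorspace.intro class_field)
qed

text \<open>
  This links linear combinations in the quotient with those of polynomials, for any choice \<open>r\<close> of
  representatives.
\<close>

lemma lincomb_gns_classes:
  assumes P: "Real_Vector_Spaces.subspace P" "P \<subseteq> polys (d + 1)"
    and A: "finite A" "\<And>v. v \<in> A \<Longrightarrow> r v \<in> P \<and> gns_class d L (r v) = v"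
  shows "module.lincomb (gns_space d L\<lparr>carrier := gns_class d L ` P\<rparr>) a A =
    gns_class d L (\<Sum>v\<in>A. a v *\<^sub>R r v)" (is "module.lincomb ?G _ _ = _")
proof -
  note P_closed = subspace_0[OF P(1)] subspace_add[OF P(1)] subspace_scale[OF P(1)]
    subspace_sum[OF P(1)]
  interpret vectorspace class_ring ?G by (rule vectorspace_gns_classes[OF P])
  have PV: "p \<in> polys (d + 1)" if "p \<in> P" for p using P that by auto
  have sm: "a v \<odot>\<^bsub>?G\<^esub> v = gns_class d L (a v *\<^sub>R r v)" if "v \<in> A" for v
    using gns_smult[of "r v" "a v"] A(2)[OF that] PV by simp
  have "(\<Oplus>\<^bsub>?G\<^esub>v\<in>A. a v \<odot>\<^bsub>?G\<^esub> v) = gns_class d L (\<Sum>v\<in>A. a v *\<^sub>R r v)"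
    using A(1) sm A(2)
  proof (induction A rule: finite_induct)
    case empty
    then show ?case by (simp add: gns_zero)
  next
    case (insert x F)
    have "(\<Oplus>\<^bsub>?G\<^esub>v\<in>insert x F. a v \<odot>\<^bsub>?G\<^esub> v) = a x \<odot>\<^bsub>?G\<^esub> x \<oplus>\<^bsub>?G\<^esub> (\<Oplus>\<^bsub>?G\<^esub>v\<in>F. a v \<odot>\<^bsub>?G\<^esub> v)"
      using insert.hyps insert.prems P_closed by (intro finsum_insert) auto
    also have "\<dots> = gns_class d L (a x *\<^sub>R r x) \<oplus>\<^bsub>gns_space d L\<^esub> gns_class d L (\<Sum>v\<in>F. a v *\<^sub>R r v)"
      using insert by simp
    also have "\<dots> = gns_class d L (a x *\<^sub>R r x + (\<Sum>v\<in>F. a v *\<^sub>R r v))"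
      using insert.prems by (intro gns_add PV P_closed) auto
    finally show ?case using insert.hyps by simp
  qed
  then show ?thesis by (simp add: lincomb_def)
qed

lemma gns_minus:
  assumes p: "p \<in> polys (d + 1)" and q: "q \<in> polys (d + 1)"
  shows "gns_class d L p \<ominus>\<^bsub>gns_space d L\<^esub> gns_class d L q = gns_class d L (p - q)"
proof -
  interpret vectorspace class_ring "gns_space d L"
    using vectorspace_gns_classes[OF subspace_polys[of "d + 1"] order_refl] gns_space_carrier by simp
  have car: "gns_class d L r \<in> carrier (gns_space d L)" if "r \<in> polys (d + 1)" for r
    using that by (subst gns_space_carrier) simp
  have mq: "- q \<in> polys (d + 1)" using V_closed(4)[of q "-1"] q by simp
  have "\<ominus>\<^bsub>gns_space d L\<^esub> gns_class d L q = gns_class d L (- q)"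
    using q mq car by (intro minus_equality) (auto simp: gns_add gns_zero)
  then show ?thesis using gns_add[OF p mq] by (simp add: a_minus_def)
qed

lemma gns_inner_class:
  assumes p: "p \<in> polys (d + 1)" and q: "q \<in> polys (d + 1)"
  shows "gns_inner d L (gns_class d L p) (gns_class d L q) = L (p * q)"
  unfolding gns_inner_def
proof (rule the_equality)
  show "\<exists>p'\<in>gns_class d L p. \<exists>q'\<in>gns_class d L q. L (p * q) = L (p' * q')"
    using gns_class_self[OF p] gns_class_self[OF q] by blast
  fix r assume "\<exists>p'\<in>gns_class d L p. \<exists>q'\<in>gns_class d L q. r = L (p' * q')"
  then obtain p' q' where "r = L (p' * q')" "p' \<in> polys (d + 1)" "p - p' \<in> null_space"
    "q' \<in> polys (d + 1)" "q - q' \<in> null_space"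
    using p q by (auto simp: mem_gns_class)
  moreover from this have "L ((p - p') * q) = 0" "L ((q - q') * p') = 0"
    using p q by (auto simp: null_space_def)
  ultimately show "r = L (p * q)"
    using diff_left[of p p' q] diff_left[of q q' p'] p q by (simp add: mult.commute)
qed

text \<open>
  Representatives of degree at most \<open>d\<close> of an orthonormal basis of \<open>T\<^sub>L\<close>. The classes of the elements
  of \<open>span F\<close> are then exactly the elements of \<open>T\<^sub>L\<close>, each represented once.
\<close>

definition trunc_basis :: "'n mpoly set \<Rightarrow> bool" where
  "trunc_basis F \<longleftrightarrow> orthonormal F \<and> F \<subseteq> polys d \<and> (\<forall>p\<in>polys d. \<exists>f\<in>span F. p - f \<in> null_space)"

lemma trunc_basis_span: "trunc_basis F \<Longrightarrow> span F \<subseteq> polys d"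
  unfolding trunc_basis_def by (intro span_minimal subspace_polys) auto

text \<open>
  The polynomial \<open>proj F p\<close> represents the orthogonal projection: \<open>p - proj F p\<close> is orthogonal to
  \<open>span F\<close> and to the null space, hence to all polynomials of degree at most \<open>d\<close>. The projection is
  unique because the difference of two candidates lies in \<open>T\<^sub>L\<close> and is orthogonal to itself.
\<close>

lemma gns_proj_class:
  assumes F: "trunc_basis F" and p: "p \<in> polys (d + 1)"
  shows "gns_proj d L (gns_class d L p) = gns_class d L (proj F p)"
proof -
  have on: "orthonormal F" using F by (simp add: trunc_basis_def)
  have pF: "proj F p \<in> polys d" using proj_in_span trunc_basis_span[OF F] by blast
  have pF1: "proj F p \<in> polys (d + 1)" using pF polys_le by blast
  have inner: "gns_inner d L (gns_class d L p \<ominus>\<^bsub>gns_space d L\<^esub> gns_class d L b) (gns_class d L c)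
      = L ((p - b) * c)" if "b \<in> polys d" "c \<in> polys d" for b c
  proof -
    have "b \<in> polys (d + 1)" "c \<in> polys (d + 1)" using that polys_le by auto
    then show ?thesis using p by (simp only: gns_minus gns_inner_class V_closed(3))
  qed
  have orth: "L ((p - proj F p) * c) = 0" if c: "c \<in> polys d" for c
  proof -
    obtain f where f: "f \<in> span F" "c - f \<in> null_space" using F c by (auto simp: trunc_basis_def)
    have fV: "f \<in> polys (d + 1)" using f trunc_basis_span[OF F] polys_le by blast
    have cV: "c \<in> polys (d + 1)" using c polys_le by blast
    have "L ((p - proj F p) * f) = 0"
      using B_proj[OF on p f(1)] diff_left[OF p pF1 fV] by simp
    moreover have "L ((c - f) * (p - proj F p)) = 0"
      using f p pF1 by (auto simp: null_space_def V_closed)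
    ultimately show ?thesis
      using diff_right[OF cV fV V_closed(3)[OF p pF1]] by (simp add: mult.commute)
  qed
  show ?thesis unfolding gns_proj_def
  proof (rule the_equality)
    show "gns_class d L (proj F p) \<in> gns_trunc d L \<and>
      (\<forall>C\<in>gns_trunc d L. gns_inner d L
        (gns_class d L p \<ominus>\<^bsub>gns_space d L\<^esub> gns_class d L (proj F p)) C = 0)"
      using pF orth by (auto simp: gns_trunc_def inner)
  next
    fix B assume B: "B \<in> gns_trunc d L \<and>
      (\<forall>C\<in>gns_trunc d L. gns_inner d L (gns_class d L p \<ominus>\<^bsub>gns_space d L\<^esub> B) C = 0)"
    then obtain b where b: "b \<in> polys d" "B = gns_class d L b" by (auto simp: gns_trunc_def)
    have b1: "b \<in> polys (d + 1)" using b polys_le by blast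
    define e where "e = b - proj F p"
    have e: "e \<in> polys d" unfolding e_def using b pF subspace_diff[OF subspace_polys] by blast
    have e1: "e \<in> polys (d + 1)" using e polys_le by blast
    have "L ((p - b) * e) = 0" using B b e inner[OF b(1) e] by (auto simp: gns_trunc_def)
    moreover have "L ((p - proj F p) * e) = 0" by (rule orth[OF e])
    ultimately have "L (e * e) = 0"
      using diff_left[OF p b1 e1] diff_left[OF p pF1 e1] diff_left[OF b1 pF1 e1]
      by (simp add: e_def)
    then have "b - proj F p \<in> null_space" using e1 by (simp add: null_space_iff e_def)
    then show "B = gns_class d L (proj F p)" using b b1 pF1 by (simp add: gns_class_eq_iff)
  qed
qed

lemma mvar_mult_closed: "p \<in> polys d \<Longrightarrow> mvar i * p \<in> polys (d + 1)"
  using polys_mult[OF mvar_in_polys, of p d i] by (simp add: add.commute)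

text \<open>
  The Fourier coefficients satisfy \<open>L(X\<^sub>i q f) = L(q \<cdot> X\<^sub>i f)\<close> with \<open>X\<^sub>i f\<close> of degree at most \<open>d + 1\<close>, so
  they depend on the class of \<open>q\<close> only, although \<open>X\<^sub>i q\<close> and \<open>X\<^sub>i p\<close> need not be congruent.
\<close>

lemma gns_mult_class:
  assumes F: "trunc_basis F" and p: "p \<in> polys d"
  shows "gns_mult d L i (gns_class d L p) = gns_class d L (proj F (mvar i * p))"
proof -
  have p1: "p \<in> polys (d + 1)" using p polys_le by blast
  have "proj F (mvar i * q) = proj F (mvar i * p)" if q: "q \<in> gns_class d L p" "q \<in> polys d" for q
    unfolding proj_def
  proof (intro sum.cong refl)
    fix f assume f: "f \<in> F"
    then have f: "f \<in> polys d" using F by (auto simp: trunc_basis_def)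
    have q1: "q \<in> polys (d + 1)" using q polys_le by blast
    have "L ((p - q) * (mvar i * f)) = 0"
      using q mvar_mult_closed[OF f] p1 by (auto simp: mem_gns_class null_space_def)
    then have "L (p * (mvar i * f)) = L (q * (mvar i * f))"
      using diff_left[OF p1 q1 mvar_mult_closed[OF f]] by simp
    then show "L (mvar i * q * f) *\<^sub>R f = L (mvar i * p * f) *\<^sub>R f" by (simp add: mult_ac)
  qed
  then have *: "gns_proj d L (gns_class d L (mvar i * q)) = gns_class d L (proj F (mvar i * p))"
    if "q \<in> gns_class d L p \<inter> polys d" for q
    using that gns_proj_class[OF F mvar_mult_closed] by auto
  show ?thesis unfolding gns_mult_def
    by (intro SUP_eq_const *) (use gns_class_self[OF p1] p in blast)+
qed

text \<open>The classes of the elements of \<open>F\<close> are distinct and form a basis of \<open>T\<^sub>L\<close>.\<close>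

lemma dim_gns_trunc:
  assumes F: "trunc_basis F"
  shows "vectorspace.dim class_ring (gns_trunc_space d L) = card F"
proof -
  have sub: "Real_Vector_Spaces.subspace (polys d)" by (rule subspace_polys)
  have on: "orthonormal F" "finite F" and Fd: "F \<subseteq> polys d"
    using F by (auto simp: trunc_basis_def orthonormal_def)
  interpret T: vectorspace class_ring "gns_trunc_space d L"
    using vectorspace_gns_classes[OF sub polys_le] by (simp add: gns_trunc_def)
  have inj: "inj_on (gns_class d L) F"
  proof (rule inj_onI)
    fix f g assume fg: "f \<in> F" "g \<in> F" "gns_class d L f = gns_class d L g"
    then have "f - g \<in> null_space" using Fd polys_le gns_class_eq_iff by blast
    moreover have "f - g \<in> span F" using fg by (intro span_diff span_base)
    ultimately show "f = g" using span_definite[OF on(1)] by force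
  qed
  define C where "C = gns_class d L ` F"
  define r where "r = the_inv_into F (gns_class d L)"
  have finC: "finite C" using on by (simp add: C_def)
  have r: "r v \<in> polys d \<and> gns_class d L (r v) = v" if "v \<in> C" for v
    using that Fd the_inv_into_into[OF inj that[unfolded C_def] order_refl]
      f_the_inv_into_f[OF inj that[unfolded C_def]] by (auto simp: r_def)
  have lc: "T.lincomb a C = gns_class d L (\<Sum>f\<in>F. a (gns_class d L f) *\<^sub>R f)" for a
  proof -
    have "T.lincomb a C = gns_class d L (\<Sum>v\<in>C. a v *\<^sub>R r v)"
      using lincomb_gns_classes[OF sub polys_le finC r] by (simp add: gns_trunc_def)
    also have "(\<Sum>v\<in>C. a v *\<^sub>R r v) = (\<Sum>f\<in>F. a (gns_class d L f) *\<^sub>R f)"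
      unfolding C_def using inj by (simp add: sum.reindex r_def the_inv_into_f_f)
    finally show ?thesis .
  qed
  have Ccar: "C \<subseteq> carrier (gns_trunc_space d L)" using Fd by (auto simp: C_def gns_trunc_def)
  have "\<not> T.lin_dep C"
  proof (rule T.finite_lin_indpt2[OF finC Ccar])
    fix a :: "'n mpoly set \<Rightarrow> real"
    assume "T.lincomb a C = \<zero>\<^bsub>gns_trunc_space d L\<^esub>"
    then have eq: "gns_class d L (\<Sum>f\<in>F. a (gns_class d L f) *\<^sub>R f) = gns_class d L 0"
      by (simp add: lc gns_zero)
    let ?s = "\<Sum>f\<in>F. a (gns_class d L f) *\<^sub>R f"
    have s: "?s \<in> span F" by (intro span_sum span_scale span_base)
    then have "?s \<in> polys (d + 1)" using trunc_basis_span[OF F] polys_le by blast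
    then have "?s \<in> null_space" using eq gns_class_eq_iff[of ?s 0] V_closed(1) by simp
    then have "?s = 0" using span_definite[OF on(1) s] by simp
    have "a (gns_class d L f) = 0" if f: "f \<in> F" for f
    proof -
      have "a (gns_class d L f) = L (?s * f)" by (rule orthonormal_sum[OF on(1) f, symmetric])
      also have "\<dots> = 0" unfolding \<open>?s = 0\<close> using f Fd polys_le by (intro zero_left) blast
      finally show ?thesis .
    qed
    then show "\<forall>v\<in>C. a v = \<zero>\<^bsub>class_ring\<^esub>" by (simp add: C_def)
  qed
  moreover have "T.span C
      = carrier (gns_trunc_space d L)"
  proof
    show "T.span C
      \<subseteq> carrier (gns_trunc_space d L)" using T.span_closed[OF Ccar] by blast
    show "carrier (gns_trunc_space d L)
      \<subseteq> T.span C"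
    proof
      fix v assume "v \<in> carrier (gns_trunc_space d L)"
      then obtain p where p: "p \<in> polys d" "v = gns_class d L p" by (auto simp: gns_trunc_def)
      obtain f where f: "f \<in> span F" "p - f \<in> null_space"
        using F p by (auto simp: trunc_basis_def)
      obtain c where c: "f = (\<Sum>g\<in>F. c g *\<^sub>R g)" using f on by (auto simp: span_finite)
      have "f \<in> polys (d + 1)" "p \<in> polys (d + 1)"
        using f p trunc_basis_span[OF F] polys_le by auto
      then have "v = gns_class d L f" using f p by (simp add: gns_class_eq_iff)
      also have "\<dots> = T.lincomb (c \<circ> r) C"
        unfolding lc using inj by (simp add: c r_def the_inv_into_f_f)
      finally show "v \<in> T.span C"
        using finC unfolding T.span_def by force
    qed
  qed
  ultimately have "T.basis C" using Ccar by (simp add: T.basis_def)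
  then have "T.dim = card C" by (intro T.dim_basis finC)
  then show ?thesis using inj by (simp add: C_def card_image)
qed

text \<open>
  A finite set \<open>S\<close> that spans the polynomials of degree at most \<open>d\<close> modulo the null space consists of
  the monomials if \<open>d\<close> is finite, and of representatives of a finite generating set of \<open>T\<^sub>L\<close> if
  \<open>d = \<infinity>\<close>. Gram--Schmidt applied to \<open>S\<close> gives the basis.
\<close>

lemma trunc_basis_exists:
  assumes fd: "d = \<infinity> \<longrightarrow> vectorspace.fin_dim class_ring (gns_trunc_space d L)"
  shows "\<exists>F. trunc_basis F"
proof -
  have "\<exists>S. finite S \<and> S \<subseteq> polys d \<and> (\<forall>p\<in>polys d. \<exists>t\<in>span S. p - t \<in> null_space)"
  proof (cases d)
    case (enat k)
    then obtain S where "finite S" "S \<subseteq> polys d" "polys d \<subseteq> span (S :: 'n mpoly set)"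
      using polys_enat_finite_span by blast
    then show ?thesis using null_closed(1) by (intro exI[of _ S]) force
  next
    case infinity
    interpret T: vectorspace class_ring "gns_trunc_space d L"
      using vectorspace_gns_classes[OF subspace_polys polys_le] by (simp add: gns_trunc_def)
    obtain A where A: "finite A" "A \<subseteq> gns_trunc d L"
      "T.span A = gns_trunc d L"
    proof -
      have "T.fin_dim" using fd infinity by blast
      then show ?thesis using that unfolding T.fin_dim_def by auto
    qed
    define r where "r = inv_into (polys d) (gns_class d L)"
    have r: "r v \<in> polys d \<and> gns_class d L (r v) = v" if "v \<in> A" for v
      using that A(2) inv_into_into[of v "gns_class d L" "polys d"]
        f_inv_into_f[of v "gns_class d L" "polys d"] by (auto simp: r_def gns_trunc_def)
    have "\<exists>t\<in>span (r ` A). p - t \<in> null_space" if p: "p \<in> polys d" for p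
    proof -
      have "gns_class d L p \<in> T.span A"
        using A(3) p by (auto simp: gns_trunc_def)
      then obtain a D where D: "finite D" "D \<subseteq> A" "gns_class d L p = T.lincomb a D"
        unfolding T.span_def by blast
      have rD: "\<And>v. v \<in> D \<Longrightarrow> r v \<in> polys d \<and> gns_class d L (r v) = v" using r D(2) by auto
      let ?t = "\<Sum>v\<in>D. a v *\<^sub>R r v"
      have "gns_class d L p = gns_class d L ?t"
        using lincomb_gns_classes[OF subspace_polys polys_le D(1) rD] D(3)
        by (simp add: gns_trunc_def)
      moreover have "?t \<in> polys d" using rD
        by (intro subspace_sum[OF subspace_polys] subspace_scale[OF subspace_polys]) auto
      ultimately have "p - ?t \<in> null_space"
        using p polys_le gns_class_eq_iff by blast
      moreover have "?t \<in> span (r ` A)"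
        using D(2) by (intro span_sum span_scale span_base) auto
      ultimately show ?thesis by blast
    qed
    then show ?thesis using A(1) r by (intro exI[of _ "r ` A"]) auto
  qed
  then obtain S where S: "finite S" "S \<subseteq> polys d" "\<forall>p\<in>polys d. \<exists>t\<in>span S. p - t \<in> null_space"
    by auto
  obtain F where F: "orthonormal F" "F \<subseteq> span S" "\<forall>s\<in>S. \<exists>f\<in>span F. s - f \<in> null_space"
    using gram_schmidt[OF S(1)] S(2) polys_le by blast
  have "\<exists>f\<in>span F. p - f \<in> null_space" if p: "p \<in> polys d" for p
  proof -
    let ?Q = "{t. \<exists>f\<in>span F. t - f \<in> null_space}"
    have "Real_Vector_Spaces.subspace ?Q"
      unfolding Real_Vector_Spaces.subspace_def
    proof (intro conjI allI ballI)
      show "0 \<in> ?Q" using null_closed(1) span_zero by force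
    next
      fix x y assume "x \<in> ?Q" "y \<in> ?Q"
      then obtain f g where "f \<in> span F" "x - f \<in> null_space" "g \<in> span F" "y - g \<in> null_space" by auto
      then have "(x - f) + (y - g) \<in> null_space" "f + g \<in> span F"
        by (auto intro: null_closed span_add)
      then show "x + y \<in> ?Q" by (auto simp: algebra_simps intro!: bexI[of _ "f + g"])
    next
      fix c x assume "x \<in> ?Q"
      then obtain f where "f \<in> span F" "x - f \<in> null_space" by auto
      then have "c *\<^sub>R (x - f) \<in> null_space" "c *\<^sub>R f \<in> span F"
        by (auto intro: null_closed span_scale)
      then show "c *\<^sub>R x \<in> ?Q" by (auto simp: scaleR_diff_right)
    qed
    then have sp: "span S \<subseteq> ?Q" using F(3) by (intro span_minimal) auto
    obtain t where t: "t \<in> span S" "p - t \<in> null_space" using S(3) p by auto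
    then obtain f where f: "f \<in> span F" "t - f \<in> null_space" using sp by auto
    have "(p - t) + (t - f) \<in> null_space" by (rule null_closed(2)[OF t(2) f(2)])
    then show ?thesis using f by auto
  qed
  moreover have "F \<subseteq> polys d"
    using F(2) span_minimal[OF S(2) subspace_polys] by blast
  ultimately show ?thesis using F(1) by (auto simp: trunc_basis_def)
qed

section \<open>The quadrature rule\<close>

text \<open>
  Multiplication by \<open>X\<^sub>i\<close> is only compressed to \<open>T\<^sub>L\<close>, so a joint eigenvector \<open>f\<close> with eigenvalues \<open>y\<close>
  satisfies the eigenvalue equation only when tested against \<open>q\<close> of degree at most \<open>d\<close>. Splitting one
  variable off a monomial of degree at most \<open>d + 1\<close> leaves exactly such a \<open>q\<close>, which is why evaluation
  at \<open>y\<close> is obtained up to degree \<open>d + 1\<close>.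
\<close>

lemma eval_of_joint_eigenvector:
  assumes f: "f \<in> polys d"
    and ev: "\<And>i q. q \<in> polys d \<Longrightarrow> L ((mvar i * f) * q) = y $ i * L (f * q)"
    and p: "p \<in> polys (d + 1)"
  shows "L (p * f) = meval p y * L f"
proof -
  have f1: "f \<in> polys (d + 1)" using f polys_le by blast
  have mono: "L (monomial m * f) = meval (monomial m) y * L f" if "enat (monom_degree m) \<le> d + 1" for m
    using that
  proof (induction "monom_degree m" arbitrary: m rule: less_induct)
    case less
    show ?case
    proof (cases "m = 0")
      case True
      then show ?thesis by (simp add: meval_monomial[of 0, simplified])
    next
      case False
      then obtain i m' where m: "monomial m = mvar i * monomial m'"
        "monom_degree m = Suc (monom_degree m')" by (rule monomial_split)
      have le: "enat (monom_degree m') \<le> d"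
        using less.prems m(2) by (cases d) (auto simp: one_enat_def)
      have "L (monomial m * f) = L ((mvar i * f) * monomial m')" by (simp add: m mult_ac)
      also have "\<dots> = y $ i * L (monomial m' * f)"
        using ev[OF monomial_in_polys[OF le], of i] by (simp add: mult.commute)
      also have "L (monomial m' * f) = meval (monomial m') y * L f"
        using le by (intro less.hyps) (auto simp: m(2) intro: order_trans)
      also have "y $ i * (meval (monomial m') y * L f) = meval (monomial m) y * L f"
        by (simp add: m meval_mult meval_mvar)
      finally show ?thesis .
    qed
  qed
  let ?K = "Poly_Mapping.keys p" and ?c = "Poly_Mapping.lookup p"
  have deg: "enat (monom_degree m) \<le> d + 1" if "m \<in> ?K" for m using p that by (simp add: polys_def)
  have "L (p * f) = L ((\<Sum>m\<in>?K. ?c m *\<^sub>R monomial m) * f)"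
    by (simp only: sum_monomials[symmetric])
  also have "\<dots> = (\<Sum>m\<in>?K. ?c m * L (monomial m * f))"
    using deg f1 by (intro sum_left monomial_in_polys)
  also have "\<dots> = (\<Sum>m\<in>?K. ?c m * meval (monomial m) y) * L f"
    using mono deg by (simp add: sum_distrib_right mult.assoc)
  also have "(\<Sum>m\<in>?K. ?c m * meval (monomial m) y) = meval p y"
    by (simp add: meval_def[of p] meval_monomial)
  finally show ?thesis .
qed

lemma trunc_basis_residual:
  assumes F: "trunc_basis F" and q: "q \<in> polys d"
  shows "q - proj F q \<in> null_space"
proof -
  have on: "orthonormal F" using F by (simp add: trunc_basis_def)
  obtain f where f: "f \<in> span F" "q - f \<in> null_space" using F q by (auto simp: trunc_basis_def)
  have "proj F q = proj F (f + (q - f))" by simp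
  also have "\<dots> = proj F f + proj F (q - f)"
    using f span_orthonormal_subset[OF on] by (intro proj_add on) (auto simp: null_space_def)
  also have "proj F (q - f) = 0"
    unfolding proj_def using f(2) on by (intro sum.neutral) (auto simp: null_space_def orthonormal_def)
  also have "proj F f = f" by (rule span_orthonormal_repr[OF on f(1)])
  finally show ?thesis using f(2) by simp
qed

lemma L_sum:
  assumes "\<And>i. i \<in> I \<Longrightarrow> p i \<in> polys (2 * d + 2)"
  shows "L (\<Sum>i\<in>I. p i) = (\<Sum>i\<in>I. L (p i))"
  using assms
proof (induction I rule: infinite_finite_induct)
  case (insert x F)
  then have "(\<Sum>i\<in>F. p i) \<in> polys (2 * d + 2)" by (intro subspace_sum[OF subspace_polys]) auto
  then show ?case using lin insert by (simp add: linear_form_def)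
qed (use zero_left[OF V_closed(1)] in simp_all)

text \<open>
  On \<open>span F\<close> the compressed multiplications \<open>p \<mapsto> proj F (X\<^sub>i p)\<close> are genuine operators on a
  positive definite space. They are self-adjoint because \<open>L(X\<^sub>i p q)\<close> is symmetric in \<open>p\<close> and \<open>q\<close>, and
  they commute because the operators \<open>M\<^sub>L\<^sub>,\<^sub>i\<close> that they represent do.
\<close>

lemma joint_eigenbasis_of_gns_mults:
  assumes comm: "gns_mults_commute d L" and F: "trunc_basis F"
  obtains G y where "trunc_basis G"
    "\<And>g i q. g \<in> G \<Longrightarrow> q \<in> polys d \<Longrightarrow> L ((mvar i * g) * q) = (y g :: real ^ 'n) $ i * L (g * q)"
proof -
  have on: "orthonormal F" "finite F" using F by (auto simp: trunc_basis_def orthonormal_def)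
  have sF: "p \<in> polys d" "p \<in> polys (d + 1)" if "p \<in> span F" for p
    using that trunc_basis_span[OF F] polys_le by auto
  define M where "M i p = proj F (mvar i * p)" for i p
  have MF: "M i p \<in> span F" for i p unfolding M_def by (rule proj_in_span)
  have BM: "L (M i p * q) = L (mvar i * p * q)" if "p \<in> span F" "q \<in> span F" for i p q
    unfolding M_def using that by (intro B_proj[OF on(1)] mvar_mult_closed sF)
  have selfadjoint: "selfadjoint_on (span F) (\<lambda>p q. L (p * q)) (M i)" for i
  proof
    fix p q assume p: "p \<in> span F" and q: "q \<in> span F"
    show "M i (p + q) = M i p + M i q"
      unfolding M_def distrib_left using p q by (intro proj_add[OF on(1)] mvar_mult_closed sF)
    show "L (M i p * q) = L (p * M i q)"
      using BM[OF p q] BM[OF q p] by (simp add: mult_ac)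
  next
    fix c p assume p: "p \<in> span F"
    show "M i (c *\<^sub>R p) = c *\<^sub>R M i p"
      unfolding M_def scaleR_mult_right using p by (intro proj_scale[OF on(1)] mvar_mult_closed sF)
  next
    fix p assume p: "p \<in> span F" "L (p * p) = 0"
    then show "p = 0" using span_definite[OF on(1)] sF by (auto simp: null_space_iff)
  qed (use sF MF add_left scale_left nonneg in \<open>auto simp: mult.commute\<close>)
  have commute: "M i (M j p) = M j (M i p)" if p: "p \<in> span F" for i j p
  proof -
    have mult: "gns_mult d L k (gns_class d L q) = gns_class d L (M k q)" if "q \<in> span F" for k q
      unfolding M_def using gns_mult_class[OF F sF(1)[OF that]] .
    have "gns_class d L p \<in> gns_trunc d L" using sF(1)[OF p] by (simp add: gns_trunc_def)
    then have "gns_class d L (M i (M j p)) = gns_class d L (M j (M i p))"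
      using comm p MF by (metis gns_mults_commute_def mult)
    then have "M i (M j p) - M j (M i p) \<in> null_space"
      using gns_class_eq_iff MF sF by blast
    then show ?thesis using span_definite[OF on(1) span_diff[OF MF MF]] by force
  qed
  interpret C: commuting_selfadjoint_on "span F" "\<lambda>p q. L (p * q)" M
    by (intro commuting_selfadjoint_on.intro selfadjoint commute exI[of _ F] conjI on(2) order_refl)
  obtain G z where G: "C.orthonormal G" "span G = span F" "\<And>g i. g \<in> G \<Longrightarrow> M i g = z g i *\<^sub>R g"
    using C.joint_eigenbasis_exists by blast
  have GF: "G \<subseteq> span F" using G(1) by (simp add: C.orthonormal_def)
  have "orthonormal G" using G(1) sF by (auto simp: C.orthonormal_def orthonormal_def)
  then have tG: "trunc_basis G" using F GF sF G(2) by (auto simp: trunc_basis_def)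
  have "L ((mvar i * g) * q) = (\<chi> i. z g i) $ i * L (g * q)" if g: "g \<in> G" and q: "q \<in> polys d" for g i q
  proof -
    obtain f where f: "f \<in> span F" "q - f \<in> null_space" using F q by (auto simp: trunc_basis_def)
    have gF: "g \<in> span F" using g GF by blast
    have q1: "q \<in> polys (d + 1)" using q polys_le by blast
    have "L (h * q) = L (h * f)" if h: "h \<in> polys (d + 1)" for h
      using f(2) diff_left[OF q1 sF(2)[OF f(1)] h] h by (simp add: null_space_def mult.commute)
    \<comment> \<open>the test polynomial \<open>q\<close> may be replaced by its representative \<open>f\<close> in \<open>span F\<close>\<close>
    note red = this[OF mvar_mult_closed[OF sF(1)[OF gF], of i]] this[OF sF(2)[OF gF]]
    have "L (mvar i * g * f) = L ((z g i *\<^sub>R g) * f)"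
      using BM[OF gF f(1), of i] G(3)[OF g] by simp
    also have "\<dots> = z g i * L (g * f)"
      using sF(2)[OF gF] sF(2)[OF f(1)] by (rule scale_left)
    finally show ?thesis using red by simp
  qed
  then show ?thesis using that[OF tG, of "\<lambda>g. \<chi> i. z g i"] by blast
qed

text \<open>
  For a joint eigenbasis \<open>G\<close> the relation \<open>L(p g) = p(y\<^sub>g) L(g)\<close> with \<open>p\<close> of degree at most \<open>d + 1\<close> does
  everything. Applied to \<open>p = g\<close> it gives \<open>L(g) \<noteq> 0\<close>; applied to the elements of \<open>G\<close> it gives
  \<open>h(y\<^sub>g) L(g) = \<delta>\<^sub>g\<^sub>h\<close>, so the nodes are distinct; applied to a null vector it shows that null vectors
  vanish at the nodes; and Parseval's identity \<open>L(p a) = \<Sum>\<^sub>g L(p g) L(a g)\<close> for \<open>a\<close> of degree at most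
  \<open>d\<close> turns into the quadrature rule with the weights \<open>L(g)\<^sup>2\<close>.
\<close>

theorem quadrature_of_joint_eigenbasis:
  assumes G: "trunc_basis G"
    and ev: "\<And>g i q. g \<in> G \<Longrightarrow> q \<in> polys d \<Longrightarrow> L ((mvar i * g) * q) = (y g :: real ^ 'n) $ i * L (g * q)"
  shows "\<exists>w. quadrature_rule L (quad_domain d L) (y ` G) w" and "inj_on y G"
proof -
  have on: "orthonormal G" "finite G" and Gd: "\<And>g. g \<in> G \<Longrightarrow> g \<in> polys d"
    using G by (auto simp: trunc_basis_def orthonormal_def)
  have Gd1: "g \<in> polys (d + 1)" if "g \<in> G" for g using Gd[OF that] polys_le by blast
  have eval: "L (p * g) = meval p (y g) * L g" if "g \<in> G" "p \<in> polys (d + 1)" for p g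
    using Gd[OF that(1)] ev[OF that(1)] that(2) by (rule eval_of_joint_eigenvector)
  have ip: "L (g * h) = (if g = h then 1 else 0)" if "g \<in> G" "h \<in> G" for g h
    using on that by (simp add: orthonormal_def)
  have nz: "L g \<noteq> 0" if "g \<in> G" for g
    using eval[OF that Gd1[OF that]] ip[OF that that] by auto
  show inj: "inj_on y G"
  proof (rule inj_onI, rule ccontr)
    fix g h assume gh: "g \<in> G" "h \<in> G" "y g = y h" "g \<noteq> h"
    have "meval h (y g) * L g = 0" using eval[OF gh(1) Gd1[OF gh(2)]] ip[OF gh(2,1)] gh(4) by simp
    then have "meval h (y h) = 0" using nz gh by simp
    then show False using eval[OF gh(2) Gd1[OF gh(2)]] ip[OF gh(2,2)] by simp
  qed
  define w where "w x = (L (the_inv_into G y x))\<^sup>2" for x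
  have sum_w: "(\<Sum>x\<in>y ` G. w x * meval p x) = (\<Sum>g\<in>G. (L g)\<^sup>2 * meval p (y g))" for p
    using inj by (simp add: sum.reindex w_def the_inv_into_f_f)
  have prod: "p * q \<in> polys (2 * d + 2) \<and> L (p * q) = (\<Sum>g\<in>G. (L g)\<^sup>2 * meval (p * q) (y g))"
    if p: "p \<in> polys (d + 1)" and q: "q \<in> {a + u | a u. a \<in> polys d \<and> u \<in> gns_kernel d L}" for p q
  proof -
    obtain a u where au: "q = a + u" "a \<in> polys d" "u \<in> null_space"
      using q by (auto simp: null_space_eq)
    have a1: "a \<in> polys (d + 1)" and u1: "u \<in> polys (d + 1)"
      using au polys_le by (auto simp: null_space_def)
    \<comment> \<open>the summand \<open>u\<close> contributes neither to \<open>L(p q)\<close> nor to the values at the nodes\<close>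
    have u0: "meval u (y g) = 0" if "g \<in> G" for g
      using eval[OF that u1] nz[OF that] au(3) Gd1[OF that] by (simp add: null_space_def)
    have pa: "proj G a \<in> polys (d + 1)" by (rule proj_in_V[OF on(1)])
    have "L ((a - proj G a) * p) = 0" "L (u * p) = 0"
      using trunc_basis_residual[OF G au(2)] au(3) p by (auto simp: null_space_def)
    then have "L (p * q) = L (p * proj G a)"
      using add_right[OF a1 u1 p] diff_right[OF a1 pa p] by (simp add: au(1) mult.commute)
    also have "\<dots> = (\<Sum>g\<in>G. L (a * g) * L (p * g))"
      unfolding proj_def using Gd1 p by (intro sum_right) auto
    also have "\<dots> = (\<Sum>g\<in>G. (L g)\<^sup>2 * meval (p * q) (y g))"
      using p a1 by (intro sum.cong)
        (simp_all add: eval u0 au(1) meval_mult meval_add power2_eq_square)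
    finally show ?thesis using mult_closed[OF p V_closed(2)[OF a1 u1]] au(1) by simp
  qed
  have "L r = (\<Sum>g\<in>G. (L g)\<^sup>2 * meval r (y g))" if r0: "r \<in> quad_domain d L" for r
  proof -
    obtain s :: nat and p q where r: "r = (\<Sum>i<s. p i * q i)"
      and "\<forall>i<s. p i \<in> polys (d + 1) \<and> q i \<in> {a + u | a u. a \<in> polys d \<and> u \<in> gns_kernel d L}"
      using r0 unfolding quad_domain_def by blast
    then have pq: "p i \<in> polys (d + 1)"
      "q i \<in> {a + u | a u. a \<in> polys d \<and> u \<in> gns_kernel d L}" if "i < s" for i
      using that by simp_all
    have "L r = (\<Sum>i<s. L (p i * q i))"
      unfolding r using prod pq by (intro L_sum) blast
    also have "\<dots> = (\<Sum>i<s. \<Sum>g\<in>G. (L g)\<^sup>2 * meval (p i * q i) (y g))"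
      using prod[OF pq] by (intro sum.cong) auto
    also have "\<dots> = (\<Sum>g\<in>G. (L g)\<^sup>2 * meval r (y g))"
      unfolding r meval_sum sum_distrib_left by (rule sum.swap)
    finally show ?thesis .
  qed
  moreover have "0 < w x" if "x \<in> y ` G" for x
    using that nz inj by (auto simp: w_def the_inv_into_f_f)
  ultimately have "quadrature_rule L (quad_domain d L) (y ` G) w"
    using on(2) by (simp add: quadrature_rule_def sum_w)
  then show "\<exists>w. quadrature_rule L (quad_domain d L) (y ` G) w" by blast
qed

end

theorem theorem5p13:
  fixes d :: enat
    and L :: "'n::finite mpoly \<Rightarrow> real"
  assumes "linear_form (2 * d + 2) L"
    and "L ` sums_of_squares (d + 1) \<subseteq> {0..}"
    and "gns_mults_commute d L"
    and "d = \<infinity> \<longrightarrow> vectorspace.fin_dim class_ring (gns_trunc_space d L)"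
  shows "\<exists>N w. quadrature_rule L (quad_domain d L) N w \<and>
           card N = vectorspace.dim class_ring (gns_trunc_space d L)"
proof -
  interpret gns_form d L using assms(1,2) by unfold_locales
  obtain F where F: "trunc_basis F" using trunc_basis_exists[OF assms(4)] by blast
  obtain G and y :: "'n mpoly \<Rightarrow> real ^ 'n" where G: "trunc_basis G"
    and ev: "\<And>g i q. g \<in> G \<Longrightarrow> q \<in> polys d \<Longrightarrow> L ((mvar i * g) * q) = y g $ i * L (g * q)"
    using joint_eigenbasis_of_gns_mults[OF assms(3) F] by blast
  have "\<exists>w. quadrature_rule L (quad_domain d L) (y ` G) w"
    and "inj_on y G" using quadrature_of_joint_eigenbasis[OF G ev] by auto
  then show ?thesis using dim_gns_trunc[OF G] by (metis card_image)
qed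

end
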